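(* Let $n\in\mathbb N$ and let $u$ be real-valued with $u\in C^\infty(\mathbb R)$, $\partial_x^ku\in L^\infty(\mathbb R)$ for $k=0,1,2$, $4u-u_{xx}>0$ on $\mathbb R$, satisfying $\mathrm{s\text{-}CH}_n(u)=0$, and suppose the associated polynomial is $R_{2n+2}(z)=\prod_{m=0}^{2n+1}(z-E_m)$ with $E_0<E_1<\cdots<E_{2n}<E_{2n+1}=0$. Then the zeros $\mu_j(x)$ and $\nu_j(x)$ of $F_n(\cdot,x)$ and $H_n(\cdot,x)$ are real and, ordered increasingly, satisfy $$\mu_j(x)\in[E_{2j-1},E_{2j}],\qquad \nu_j(x)\in[E_{2j-1},E_{2j}],\qquad j=1,\dots,n,\ x\in\mathbb R.$$ Moreover $\hat\mu_j\in C^\infty(\mathbb R,\mathcal K_n)$, $j=1,\dots,n$, and $\{\hat\mu_j\}$ satisfies the Dubrovin equations on all of $\mathbb R$; $\hat\mu_j(x)$ changes sheets whenever $\mu_j(x)$ hits $E_{2j-1}$ or $E_{2j}$.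
   Context: Stationary CH formalism. Let $n\in\mathbb N$ and $u$ real-valued, $C^\infty$ with bounded derivatives. Let $\mathcal G=(-d^2/dx^2+4)^{-1}$, i.e. $(\mathcal Gv)(x)=\frac14\int_{\mathbb R}e^{-2|x-y|}v(y)\,dy$ on $L^\infty(\mathbb R)$. Put $f_0=1$ and for $\ell\ge1$ define $f_\ell$ by $f_{\ell,x}=-2\mathcal G\big(2(4u-u_{xx})f_{\ell-1,x}+(4u_x-u_{xxx})f_{\ell-1}\big)$, $f_\ell$ being fixed up to an additive integration constant $c_\ell$ (e.g. $f_1=-2u+c_1$). Set $g_\ell=f_\ell+\frac12f_{\ell,x}$, $h_\ell=(4u-u_{xx})f_\ell-g_{\ell+1,x}$ for $0\le\ell\le n-1$, $h_n=(4u-u_{xx})f_n$, and $F_n(z,x)=\sum_{\ell=0}^nf_{n-\ell}(x)z^\ell$, $G_n(z,x)=\sum_{\ell=0}^ng_{n-\ell}(x)z^\ell$, $H_n(z,x)=\sum_{\ell=0}^nh_{n-\ell}(x)z^\ell$. The $n$th stationary CH equation is $\mathrm{s\text{-}CH}_n(u):=(u_{xxx}-4u_x)f_n-2(4u-u_{xx})f_{n,x}=0$; when it holds, $R_{2n+2}(z):=z^2G_n(z,x)^2+zF_n(z,x)H_n(z,x)$ is independent of $x$, monic of degree $2n+2$, with $R_{2n+2}(0)=0$. $\mathcal K_n$ is the hyperelliptic curve $y^2=R_{2n+2}(z)$ compactified by two points at infinity. The zeros of the monic polynomial $F_n(\cdot,x)$ are $\mu_1(x),\dots,\mu_n(x)$;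 $H_n(z,x)=h_0(x)\prod_{j=1}^n(z-\nu_j(x))$ with $h_0=4u+2u_x$; and $\hat\mu_j(x)=(\mu_j(x),-\mu_j(x)G_n(\mu_j(x),x))\in\mathcal K_n$. The Dubrovin equations are $\mu_{j,x}(x)=\frac{2\,y(\hat\mu_j(x))}{\mu_j(x)}\prod_{\ell\ne j}(\mu_j(x)-\mu_\ell(x))^{-1}$, $j=1,\dots,n$, where $y(\hat\mu_j)$ denotes the $y$-coordinate of $\hat\mu_j$ (interpreted in local coordinates $\pm(z-E_m)^{1/2}$ near branch points). *)

theory Defs
  imports "HOL-Analysis.Analysis"
begin

definition C_inf :: "(real \<Rightarrow> real) \<Rightarrow> bool" where
  "C_inf f \<longleftrightarrow> (\<forall>k x. ((deriv ^^ k) f) differentiable (at x))"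

text \<open>The operator (-d^2/dx^2 + 4)^{-1}, as the convolution with (1/4) e^{-2|x|}.\<close>
definition Gop :: "(real \<Rightarrow> real) \<Rightarrow> real \<Rightarrow> real" where
  "Gop v x = (1/4) * (LINT y|lborel. exp (-2 * \<bar>x - y\<bar>) * v y)"

definition CH_arg :: "(real \<Rightarrow> real) \<Rightarrow> (real \<Rightarrow> real) \<Rightarrow> real \<Rightarrow> real" where
  "CH_arg u f y = 2 * (4 * u y - deriv (deriv u) y) * deriv f y
                 + (4 * deriv u y - (deriv ^^ 3) u y) * f y"

text \<open>f is an admissible choice of f_0,...,f_n (with arbitrary integration constants).\<close>
definition is_f_seq :: "(real \<Rightarrow> real) \<Rightarrow> nat \<Rightarrow> (nat \<Rightarrow> real \<Rightarrow> real) \<Rightarrow> bool" where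
  "is_f_seq u n f \<longleftrightarrow> f 0 = (\<lambda>x. 1) \<and>
     (\<forall>l\<in>{1..n}. \<forall>x.
        integrable lborel (\<lambda>y. exp (-2 * \<bar>x - y\<bar>) * CH_arg u (f (l - 1)) y) \<and>
        (f l has_real_derivative (-2 * Gop (CH_arg u (f (l - 1))) x)) (at x))"

definition gg :: "(nat \<Rightarrow> real \<Rightarrow> real) \<Rightarrow> nat \<Rightarrow> real \<Rightarrow> real" where
  "gg f l x = f l x + deriv (f l) x / 2"

definition hh :: "(real \<Rightarrow> real) \<Rightarrow> nat \<Rightarrow> (nat \<Rightarrow> real \<Rightarrow> real) \<Rightarrow> nat \<Rightarrow> real \<Rightarrow> real" where
  "hh u n f l x = (if l < n then (4 * u x - deriv (deriv u) x) * f l x - deriv (gg f (l + 1)) x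
                   else (4 * u x - deriv (deriv u) x) * f l x)"

definition Fpol :: "nat \<Rightarrow> (nat \<Rightarrow> real \<Rightarrow> real) \<Rightarrow> 'a::real_algebra_1 \<Rightarrow> real \<Rightarrow> 'a" where
  "Fpol n f z x = (\<Sum>l\<le>n. of_real (f (n - l) x) * z ^ l)"

definition Gpol :: "nat \<Rightarrow> (nat \<Rightarrow> real \<Rightarrow> real) \<Rightarrow> 'a::real_algebra_1 \<Rightarrow> real \<Rightarrow> 'a" where
  "Gpol n f z x = (\<Sum>l\<le>n. of_real (gg f (n - l) x) * z ^ l)"

definition Hpol :: "(real \<Rightarrow> real) \<Rightarrow> nat \<Rightarrow> (nat \<Rightarrow> real \<Rightarrow> real) \<Rightarrow> 'a::real_algebra_1 \<Rightarrow> real \<Rightarrow> 'a" where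
  "Hpol u n f z x = (\<Sum>l\<le>n. of_real (hh u n f (n - l) x) * z ^ l)"

definition sCH :: "(real \<Rightarrow> real) \<Rightarrow> nat \<Rightarrow> (nat \<Rightarrow> real \<Rightarrow> real) \<Rightarrow> real \<Rightarrow> real" where
  "sCH u n f x = ((deriv ^^ 3) u x - 4 * deriv u x) * f n x
                 - 2 * (4 * u x - deriv (deriv u) x) * deriv (f n) x"

end

theory Submission
  imports Defs "HOL-Computational_Algebra.Polynomial"
begin

text \<open>
  Write m = 4u - u''. The polynomials satisfy F' = 2(G - F), z G' = m F - H and H' = 2H - 2m G, and all
  their coefficients are bounded in x: comparing coefficients in R = z^2 G^2 + z F H gives
  f'' = 4f + (bounded) for each coefficient f of F, and growth like exp(2|x|) is excluded because f' is
  a convolution with exp(-2|x|). Moreover m f_n^2 is a positive constant, so m is bounded below.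

  Fix z in the interior of a gap, where R > 0, and put V = H/z, Q = R/z^2. With subscripts
  for z-derivatives, the function N = G_z^2 + F_z V_z - Q_z^2/(4Q) of x satisfies
  N' = -2(m/z^2) T with T = F G_z - G F_z, and T^2 - N F^2 = (Q_z F - 2Q F_z)^2/(4Q). If N were
  positive somewhere, T would stay away from 0 from there on in one direction and N would be
  unbounded; hence N is nowhere positive. If Q_z F = 2Q F_z at a point with F nonzero, then N = T = 0 and
  T' < 0 there, so N would become positive. Hence Q/F^2 has no critical point inside a gap, and as R
  vanishes at both ends of the gap, Rolle's theorem yields a zero of F in each of the n closed gaps.
  These are all zeros of F, so they are simple; the same argument with Q/V^2 locates the zeros of H.

  The Dubrovin equations and smoothness follow from F = prod (z - mu_j). Where mu_j hits a branch point,
  G vanishes and the derivative of y = - mu_j G(mu_j, x) is H(mu_j, x), which is nonzero since R has simple zeros.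
\<close>

subsection \<open>Smooth functions\<close>

text \<open>Counting orders of differentiability makes smoothness accessible to induction on
  \<open>k\<close>, in particular for solutions of differential equations.\<close>

definition ksmooth :: "nat \<Rightarrow> (real \<Rightarrow> real) \<Rightarrow> bool" where
  "ksmooth k f \<longleftrightarrow> (\<forall>i<k. \<forall>x. ((deriv ^^ i) f) differentiable (at x))"

lemma C_inf_iff_ksmooth: "C_inf f \<longleftrightarrow> (\<forall>k. ksmooth k f)"
  unfolding C_inf_def ksmooth_def by blast

lemma ksmooth_0 [simp]: "ksmooth 0 f"
  by (simp add: ksmooth_def)

lemma ksmooth_Suc:
  "ksmooth (Suc k) f \<longleftrightarrow> (\<forall>x. f differentiable (at x)) \<and> ksmooth k (deriv f)"
proof -
  have "(\<forall>i<Suc k. P i) \<longleftrightarrow> P 0 \<and> (\<forall>i<k. P (Suc i))" for P :: "nat \<Rightarrow> bool"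
    using less_Suc_eq_0_disj by auto
  then show ?thesis
    unfolding ksmooth_def by (simp add: funpow_swap1)
qed

lemma deriv_eqI: "(\<And>x. (f has_real_derivative f' x) (at x)) \<Longrightarrow> deriv f = f'"
  by (rule ext) (rule DERIV_imp_deriv)

lemma ksmooth_SucI:
  "(\<And>x. (f has_real_derivative f' x) (at x)) \<Longrightarrow> ksmooth k f' \<Longrightarrow> ksmooth (Suc k) f"
  using deriv_eqI[of f f'] by (auto simp: ksmooth_Suc real_differentiable_def)

lemma ksmooth_Suc_has_deriv:
  "ksmooth (Suc k) f \<Longrightarrow> (f has_real_derivative deriv f x) (at x)"
  by (simp add: ksmooth_Suc DERIV_deriv_iff_real_differentiable)

lemma ksmooth_SucD: "ksmooth (Suc k) f \<Longrightarrow> ksmooth k f"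
  by (simp add: ksmooth_def)

lemma ksmooth_const: "ksmooth k (\<lambda>x. c)"
proof (induction k arbitrary: c)
  case (Suc k)
  show ?case by (rule ksmooth_SucI[of _ "\<lambda>x. 0"]) (auto simp: Suc)
qed simp

lemma ksmooth_add: "ksmooth k f \<Longrightarrow> ksmooth k g \<Longrightarrow> ksmooth k (\<lambda>x. f x + g x)"
proof (induction k arbitrary: f g)
  case (Suc k)
  show ?case
    by (rule ksmooth_SucI[of _ "\<lambda>x. deriv f x + deriv g x"])
      (use Suc in \<open>auto intro!: derivative_intros ksmooth_Suc_has_deriv simp: ksmooth_Suc\<close>)
qed simp

lemma ksmooth_mult: "ksmooth k f \<Longrightarrow> ksmooth k g \<Longrightarrow> ksmooth k (\<lambda>x. f x * g x)"
proof (induction k arbitrary: f g)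
  case (Suc k)
  have d: "((\<lambda>x. f x * g x) has_real_derivative f x * deriv g x + deriv f x * g x) (at x)" for x
    by (rule DERIV_cong[OF DERIV_mult'[OF ksmooth_Suc_has_deriv[OF Suc.prems(1)]
            ksmooth_Suc_has_deriv[OF Suc.prems(2)]]]) simp
  have "ksmooth k f" "ksmooth k g" "ksmooth k (deriv f)" "ksmooth k (deriv g)"
    using Suc.prems ksmooth_SucD ksmooth_Suc by blast+
  then show ?case
    by (intro ksmooth_SucI[OF d] ksmooth_add Suc.IH)
qed simp

lemma ksmooth_cmult: "ksmooth k f \<Longrightarrow> ksmooth k (\<lambda>x. c * f x)"
  by (intro ksmooth_mult ksmooth_const)

lemma ksmooth_minus: "ksmooth k f \<Longrightarrow> ksmooth k (\<lambda>x. - f x)"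
  using ksmooth_cmult[of k f "-1"] by simp

lemma ksmooth_diff: "ksmooth k f \<Longrightarrow> ksmooth k g \<Longrightarrow> ksmooth k (\<lambda>x. f x - g x)"
  using ksmooth_add[OF _ ksmooth_minus, of k f g] by simp

lemma ksmooth_inverse:
  "ksmooth k f \<Longrightarrow> (\<And>x. f x \<noteq> 0) \<Longrightarrow> ksmooth k (\<lambda>x. inverse (f x))"
proof (induction k)
  case (Suc k)
  have d: "((\<lambda>x. inverse (f x)) has_real_derivative
      - (inverse (f x) * deriv f x * inverse (f x))) (at x)" for x
    using DERIV_inverse'[OF ksmooth_Suc_has_deriv[OF Suc.prems(1)] Suc.prems(2)] .
  have "ksmooth k f" "ksmooth k (deriv f)"
    using Suc.prems(1) ksmooth_SucD ksmooth_Suc by blast+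
  then show ?case
    using Suc.prems(2) by (intro ksmooth_SucI[OF d] ksmooth_minus ksmooth_mult Suc.IH)
qed simp

lemma ksmooth_power: "ksmooth k f \<Longrightarrow> ksmooth k (\<lambda>x. f x ^ j)"
  by (induction j) (auto intro: ksmooth_const ksmooth_mult)

lemma ksmooth_sum: "(\<And>i. i \<in> I \<Longrightarrow> ksmooth k (f i)) \<Longrightarrow> ksmooth k (\<lambda>x. \<Sum>i\<in>I. f i x)"
  by (induction I rule: infinite_finite_induct) (auto intro: ksmooth_const ksmooth_add)

lemma ksmooth_prod: "(\<And>i. i \<in> I \<Longrightarrow> ksmooth k (f i)) \<Longrightarrow> ksmooth k (\<lambda>x. \<Prod>i\<in>I. f i x)"
  by (induction I rule: infinite_finite_induct) (auto intro: ksmooth_const ksmooth_mult)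

lemma C_inf_deriv: "C_inf f \<Longrightarrow> C_inf (deriv f)"
  unfolding C_inf_iff_ksmooth using ksmooth_Suc by blast

lemma C_inf_has_deriv: "C_inf f \<Longrightarrow> (f has_real_derivative deriv f x) (at x)"
  unfolding C_inf_iff_ksmooth using ksmooth_Suc_has_deriv by blast

lemma C_inf_continuous_on: "C_inf f \<Longrightarrow> continuous_on A f"
  using C_inf_has_deriv DERIV_continuous_on has_field_derivative_at_within by metis

lemma C_infI:
  assumes "\<And>x. (f has_real_derivative f' x) (at x)" "C_inf f'"
  shows "C_inf f"
  unfolding C_inf_iff_ksmooth
proof
  fix k
  show "ksmooth k f"
    using assms(2) by (intro ksmooth_SucD[OF ksmooth_SucI[OF assms(1)]]) (simp add: C_inf_iff_ksmooth)
qed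

text \<open>Bootstrapping: the equations express the derivatives of \<open>w\<close> and
  \<open>w1\<close> through \<open>w\<close>, \<open>w1\<close> and the smooth \<open>v\<close>, so
  both functions gain one order together.\<close>

lemma C_inf_ode2:
  assumes w: "\<And>x. (w has_real_derivative w1 x) (at x)"
    and w1: "\<And>x. (w1 has_real_derivative 4 * w x - v x) (at x)"
    and v: "C_inf v"
  shows "C_inf w"
proof -
  have "ksmooth k w \<and> ksmooth k w1" for k
  proof (induction k)
    case (Suc k)
    have "ksmooth k v" using v by (simp add: C_inf_iff_ksmooth)
    then show ?case
      using Suc by (auto intro!: ksmooth_SucI[OF w] ksmooth_SucI[OF w1] ksmooth_diff ksmooth_cmult)
  qed simp
  then show ?thesis by (simp add: C_inf_iff_ksmooth)
qed

lemma C_inf_arith: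
  assumes "C_inf f" "C_inf g"
  shows "C_inf (\<lambda>x. f x + g x)" "C_inf (\<lambda>x. f x - g x)" "C_inf (\<lambda>x. f x * g x)"
  using assms by (auto simp: C_inf_iff_ksmooth intro: ksmooth_add ksmooth_diff ksmooth_mult)

lemma C_inf_cmult: "C_inf f \<Longrightarrow> C_inf (\<lambda>x. c * f x)"
  by (auto simp: C_inf_iff_ksmooth intro: ksmooth_cmult)

subsection \<open>The operator Gop and bounded solutions of f'' = 4f - 2B\<close>

text \<open>Near \<open>x\<close> the integral is a constant tail below x - 1 plus an integral over
  a compact interval, where the fundamental theorem of calculus applies.\<close>

lemma set_integral_atMost_has_deriv:
  fixes g :: "real \<Rightarrow> real"
  assumes cont: "continuous_on UNIV g" and int: "\<And>x. set_integrable lborel {..x} g"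
  shows "((\<lambda>x. LINT y:{..x}|lborel. g y) has_real_derivative g x) (at x)"
proof -
  define K where "K = (LINT y:{..<x - 1}|lborel. g y)"
  have eq: "K + integral {x - 1..t} g = (LINT y:{..t}|lborel. g y)" if "t \<in> {x - 1<..<x + 1}" for t
  proof -
    have i: "set_integrable lborel {..<x - 1} g" "set_integrable lborel {x - 1..t} g"
      by (rule set_integrable_subset[OF int[of t]]; use that in auto)+
    have "{..t} = {..<x - 1} \<union> {x - 1..t}" "{..<x - 1} \<inter> {x - 1..t} = {}" using that by auto
    then show ?thesis
      using set_integral_Un[OF _ i] set_borel_integral_eq_integral(2)[OF i(2)] by (simp add: K_def)
  qed
  have "((\<lambda>t. integral {x - 1..t} g) has_real_derivative g x) (at x within {x - 1..x + 1})"
    by (intro integral_has_real_derivative continuous_on_subset[OF cont]) auto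
  then have "((\<lambda>t. K + integral {x - 1..t} g) has_real_derivative g x) (at x)"
    by (auto intro!: derivative_eq_intros simp: at_within_Icc_at)
  then show ?thesis
    by (rule has_field_derivative_transform_within_open[where S = "{x - 1<..<x + 1}"]) (use eq in auto)
qed

lemma set_integral_atLeast_has_deriv:
  fixes g :: "real \<Rightarrow> real"
  assumes cont: "continuous_on UNIV g" and int: "\<And>x. set_integrable lborel {x..} g"
  shows "((\<lambda>x. LINT y:{x..}|lborel. g y) has_real_derivative - g x) (at x)"
proof -
  define K where "K = (LINT y:{x + 1<..}|lborel. g y)"
  have eq: "K + integral {t..x + 1} g = (LINT y:{t..}|lborel. g y)" if "t \<in> {x - 1<..<x + 1}" for t
  proof -
    have i: "set_integrable lborel {x + 1<..} g" "set_integrable lborel {t..x + 1} g"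
      by (rule set_integrable_subset[OF int[of t]]; use that in auto)+
    have "{t..} = {x + 1<..} \<union> {t..x + 1}" "{x + 1<..} \<inter> {t..x + 1} = {}" using that by auto
    then show ?thesis
      using set_integral_Un[OF _ i] set_borel_integral_eq_integral(2)[OF i(2)] by (simp add: K_def)
  qed
  have "((\<lambda>t. integral {t..x + 1} g) has_real_derivative - g x) (at x within {x - 1..x + 1})"
    by (intro integral_has_real_derivative' continuous_on_subset[OF cont]) auto
  then have "((\<lambda>t. K + integral {t..x + 1} g) has_real_derivative - g x) (at x)"
    by (auto intro!: derivative_eq_intros simp: at_within_Icc_at)
  then show ?thesis
    by (rule has_field_derivative_transform_within_open[where S = "{x - 1<..<x + 1}"]) (use eq in auto)
qed

text \<open>Splitting the kernel at y = x turns the convolution into (exp(-2x) A + exp(2x) B)/4 with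
  one-sided integrals A and B. The boundary terms cancel in the first derivative and add up to - v
  in the second.\<close>

lemma Gop_ode:
  assumes cont: "continuous_on UNIV v"
    and int: "\<And>x. integrable lborel (\<lambda>y. exp (-2 * \<bar>x - y\<bar>) * v y)"
  obtains w1 where "\<And>x. (Gop v has_real_derivative w1 x) (at x)"
    "\<And>x. (w1 has_real_derivative 4 * Gop v x - v x) (at x)"
proof -
  define A where "A x = (LINT y:{..x}|lborel. exp (2 * y) * v y)" for x
  define B where "B x = (LINT y:{x..}|lborel. exp (-2 * y) * v y)" for x
  have sint: "set_integrable lborel S (\<lambda>y. exp (-2 * \<bar>x - y\<bar>) * v y)" if "S \<in> sets lborel" for S x
    by (rule set_integrable_subset[where A = UNIV]) (use int[of x] that in \<open>auto simp: set_integrable_def\<close>)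
  have eqA: "exp (-2 * \<bar>x - y\<bar>) * v y = exp (-2 * x) * (exp (2 * y) * v y)" if "y \<le> x" for x y
    using that by (simp add: mult_exp_exp)
  have eqB: "exp (-2 * \<bar>x - y\<bar>) * v y = exp (2 * x) * (exp (-2 * y) * v y)" if "y \<ge> x" for x y
    using that by (simp add: mult_exp_exp)
  have intA: "set_integrable lborel {..x} (\<lambda>y. exp (2 * y) * v y)" for x
  proof -
    have "set_integrable lborel {..x} (\<lambda>y. exp (-2 * x) * (exp (2 * y) * v y))"
      by (rule iffD1[OF set_integrable_cong[OF refl refl eqA] sint]) auto
    then show ?thesis by simp
  qed
  have intB: "set_integrable lborel {x..} (\<lambda>y. exp (-2 * y) * v y)" for x
  proof -
    have "set_integrable lborel {x..} (\<lambda>y. exp (2 * x) * (exp (-2 * y) * v y))"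
      by (rule iffD1[OF set_integrable_cong[OF refl refl eqB] sint]) auto
    then show ?thesis by simp
  qed
  have dA: "(A has_real_derivative exp (2 * x) * v x) (at x)" for x
    unfolding A_def
    by (rule set_integral_atMost_has_deriv[OF _ intA]) (intro continuous_intros cont)
  have dB: "(B has_real_derivative - (exp (-2 * x) * v x)) (at x)" for x
    unfolding B_def
    by (rule set_integral_atLeast_has_deriv[OF _ intB]) (intro continuous_intros cont)
  have Gop: "Gop v x = (1/4) * (exp (-2 * x) * A x + exp (2 * x) * B x)" for x
  proof -
    have "(LINT y|lborel. exp (-2 * \<bar>x - y\<bar>) * v y)
        = (LINT y:{..x} \<union> {x..}|lborel. exp (-2 * \<bar>x - y\<bar>) * v y)"
    proof -
      have "{..x} \<union> {x..} = (UNIV :: real set)" by auto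
      then show ?thesis by (simp add: set_lebesgue_integral_def)
    qed
    also have "\<dots> = (LINT y:{..x}|lborel. exp (-2 * \<bar>x - y\<bar>) * v y)
        + (LINT y:{x..}|lborel. exp (-2 * \<bar>x - y\<bar>) * v y)"
    proof (rule set_integral_Un_AE)
      have "AE y in lborel. y \<noteq> x" by (rule AE_lborel_singleton)
      then show "AE y in lborel. \<not> (y \<in> {..x} \<and> y \<in> {x..})" by eventually_elim auto
    qed (rule sint | simp)+
    also have "(LINT y:{..x}|lborel. exp (-2 * \<bar>x - y\<bar>) * v y) = exp (-2 * x) * A x"
    proof -
      have "(LINT y:{..x}|lborel. exp (-2 * \<bar>x - y\<bar>) * v y)
          = (LINT y:{..x}|lborel. exp (-2 * x) * (exp (2 * y) * v y))"
        by (rule set_lebesgue_integral_cong) (use eqA in auto)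
      then show ?thesis by (simp add: A_def)
    qed
    also have "(LINT y:{x..}|lborel. exp (-2 * \<bar>x - y\<bar>) * v y) = exp (2 * x) * B x"
    proof -
      have "(LINT y:{x..}|lborel. exp (-2 * \<bar>x - y\<bar>) * v y)
          = (LINT y:{x..}|lborel. exp (2 * x) * (exp (-2 * y) * v y))"
        by (rule set_lebesgue_integral_cong) (use eqB in auto)
      then show ?thesis by (simp add: B_def)
    qed
    finally show ?thesis by (simp add: Gop_def)
  qed
  have inv: "exp (-2 * x) * (exp (2 * x) * v x) = v x" "exp (2 * x) * (exp (-2 * x) * v x) = v x" for x
    by (simp_all add: mult_exp_exp flip: mult.assoc)
  show ?thesis
  proof (rule that[of "\<lambda>x. (1/2) * (exp (2 * x) * B x - exp (-2 * x) * A x)"])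
    show "(Gop v has_real_derivative (1/2) * (exp (2 * x) * B x - exp (-2 * x) * A x)) (at x)" for x
    proof -
      have "((\<lambda>x. (1/4) * (exp (-2 * x) * A x + exp (2 * x) * B x)) has_real_derivative
          (1/4) * ((exp (-2 * x) * (-2) * A x + exp (-2 * x) * (exp (2 * x) * v x))
            + (exp (2 * x) * 2 * B x + exp (2 * x) * (- (exp (-2 * x) * v x))))) (at x)"
        by (rule derivative_eq_intros dA dB refl)+ simp
      moreover have "Gop v = (\<lambda>x. (1/4) * (exp (-2 * x) * A x + exp (2 * x) * B x))"
        using Gop by (rule ext)
      ultimately show ?thesis using inv[of x] by (simp add: algebra_simps)
    qed
    show "((\<lambda>x. (1/2) * (exp (2 * x) * B x - exp (-2 * x) * A x)) has_real_derivative
        4 * Gop v x - v x) (at x)" for x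
    proof -
      have "((\<lambda>x. (1/2) * (exp (2 * x) * B x - exp (-2 * x) * A x)) has_real_derivative
          (1/2) * ((exp (2 * x) * 2 * B x + exp (2 * x) * (- (exp (-2 * x) * v x)))
            - (exp (-2 * x) * (-2) * A x + exp (-2 * x) * (exp (2 * x) * v x)))) (at x)"
        by (rule derivative_eq_intros dA dB refl)+ simp
      then show ?thesis using inv[of x] by (simp add: Gop algebra_simps exp_minus_inverse)
    qed
  qed
qed

text \<open>Dominated convergence: |y| <= t + |st - y| bounds the integrand by its absolute value at
  t = 0, which is integrable by \<open>int\<close>. The sign \<open>s\<close> covers both ends of
  the line.\<close>

lemma Gop_growth:
  assumes int: "\<And>x. integrable lborel (\<lambda>y. exp (-2 * \<bar>x - y\<bar>) * v y)"
    and s: "\<bar>s\<bar> = 1" and meas: "v \<in> borel_measurable borel"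
  shows "((\<lambda>t. exp (-2 * t) * Gop v (s * t)) \<longlongrightarrow> 0) at_top"
proof -
  have "((\<lambda>t. LINT y|lborel. exp (-2 * t) * (exp (-2 * \<bar>s * t - y\<bar>) * v y)) \<longlongrightarrow> (LINT y|(lborel :: real measure). 0 :: real)) at_top"
  proof (rule integral_dominated_convergence_at_top[where w = "\<lambda>y. \<bar>exp (-2 * \<bar>0 - y\<bar>) * v y\<bar>"])
    show "integrable lborel (\<lambda>y. \<bar>exp (-2 * \<bar>0 - y\<bar>) * v y\<bar>)"
      by (rule integrable_abs[OF int])
    show "\<forall>\<^sub>F t in at_top. AE y in lborel. norm (exp (-2 * t) * (exp (-2 * \<bar>s * t - y\<bar>) * v y))
        \<le> \<bar>exp (-2 * \<bar>0 - y\<bar>) * v y\<bar>"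
      using eventually_ge_at_top[of 0]
    proof eventually_elim
      case (elim t)
      have "\<bar>s * t\<bar> = t" using s elim by (simp add: abs_mult)
      have "exp (-2 * t) * exp (-2 * \<bar>s * t - y\<bar>) \<le> exp (-2 * \<bar>0 - y\<bar>)" for y
      proof -
        have "\<bar>y\<bar> \<le> \<bar>s * t\<bar> + \<bar>s * t - y\<bar>" by linarith
        then show ?thesis unfolding mult_exp_exp \<open>\<bar>s * t\<bar> = t\<close> by simp
      qed
      then show ?case
        by (intro always_eventually allI) (auto simp: abs_mult mult_right_mono simp flip: mult.assoc)
    qed
    show "AE y in lborel. ((\<lambda>t. exp (-2 * t) * (exp (-2 * \<bar>s * t - y\<bar>) * v y)) \<longlongrightarrow> 0) at_top"
    proof (intro always_eventually allI)
      fix y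
      show "((\<lambda>t. exp (-2 * t) * (exp (-2 * \<bar>s * t - y\<bar>) * v y)) \<longlongrightarrow> 0) at_top"
      proof (rule tendsto_rabs_zero_cancel,
          rule tendsto_sandwich[where f = "\<lambda>t. 0" and h = "\<lambda>t. exp (-2 * t) * \<bar>v y\<bar>"])
        show "((\<lambda>t. exp (-2 * t) * \<bar>v y\<bar>) \<longlongrightarrow> 0) at_top"
          by (intro tendsto_mult_left_zero filterlim_compose[OF exp_at_bot] 
              filterlim_tendsto_neg_mult_at_bot[OF tendsto_const] filterlim_ident) auto
        show "\<forall>\<^sub>F t in at_top. \<bar>exp (-2 * t) * (exp (-2 * \<bar>s * t - y\<bar>) * v y)\<bar> \<le> exp (-2 * t) * \<bar>v y\<bar>"
          by (intro always_eventually allI) (simp add: abs_mult mult_left_le_one_le)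
      qed (auto intro: always_eventually tendsto_const)
    qed
  qed (use meas in \<open>auto intro!: measurable_compose[OF _ meas]\<close>)
  then have "((\<lambda>t. (1/4) * (LINT y|lborel. exp (-2 * t) * (exp (-2 * \<bar>s * t - y\<bar>) * v y))) \<longlongrightarrow> (1/4) * 0) at_top"
    by (intro tendsto_intros) simp
  then show ?thesis
    by (simp add: Gop_def)
qed

section \<open>A priori bounds for f'' = 4f - 2B\<close>

text \<open>If the growing mode \<open>p\<close> exceeds \<open>S\<close> once, it stays above a
  positive multiple of exp(2t) from there on. After scaling by exp(-2t), the decaying mode
  \<open>q\<close> can offset this only by a term of order exp(-4t), so the sum cannot tend to
  0.\<close>

lemma bounded_mode_upper:
  fixes p q :: "real \<Rightarrow> real"
  assumes p: "\<And>x. (p has_real_derivative 2 * p x - 2 * B x) (at x)"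
    and q: "\<And>x. (q has_real_derivative - 2 * q x - 2 * B x) (at x)"
    and B: "\<And>x. \<bar>B x\<bar> \<le> S"
    and lim: "((\<lambda>t. exp (-2 * t) * (p t + q t)) \<longlongrightarrow> 0) at_top"
  shows "p x \<le> S"
proof (rule ccontr)
  assume "\<not> p x \<le> S"
  \<comment> \<open>\<open>e\<close> and \<open>C\<close> are the values at \<open>x\<close> of two
    quantities that do not decrease to the right of \<open>x\<close>.\<close>
  define e where "e = exp (-2 * x) * (p x - S)"
  have e: "e > 0" using \<open>\<not> p x \<le> S\<close> by (simp add: e_def)
  define C where "C = exp (2 * x) * (q x + S)"
  have p_le: "e \<le> exp (-2 * t) * (p t - S)" if "x \<le> t" for t
    unfolding e_def
  proof (rule DERIV_nonneg_imp_nondecreasing[OF that])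
    fix y
    have "((\<lambda>t. exp (-2 * t) * (p t - S)) has_real_derivative exp (-2 * y) * (2 * S - 2 * B y)) (at y)"
      by (rule derivative_eq_intros p refl)+ (simp add: algebra_simps)
    moreover have "exp (-2 * y) * (2 * S - 2 * B y) \<ge> 0" using B[of y] by simp
    ultimately show "\<exists>d. ((\<lambda>t. exp (-2 * t) * (p t - S)) has_real_derivative d) (at y) \<and> 0 \<le> d" by blast
  qed
  have q_le: "C \<le> exp (2 * t) * (q t + S)" if "x \<le> t" for t
    unfolding C_def
  proof (rule DERIV_nonneg_imp_nondecreasing[OF that])
    fix y
    have "((\<lambda>t. exp (2 * t) * (q t + S)) has_real_derivative exp (2 * y) * (2 * S - 2 * B y)) (at y)"
      by (rule derivative_eq_intros q refl)+ (simp add: algebra_simps)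
    moreover have "exp (2 * y) * (2 * S - 2 * B y) \<ge> 0" using B[of y] by simp
    ultimately show "\<exists>d. ((\<lambda>t. exp (2 * t) * (q t + S)) has_real_derivative d) (at y) \<and> 0 \<le> d" by blast
  qed
  have lower: "e + exp (-4 * t) * C \<le> exp (-2 * t) * (p t + q t)" if "x \<le> t" for t
  proof -
    have "exp (-4 * t) * C \<le> exp (-4 * t) * (exp (2 * t) * (q t + S))"
      using q_le[OF that] by simp
    also have "\<dots> = exp (-2 * t) * (q t + S)"
      by (simp add: mult_exp_exp flip: mult.assoc)
    finally show ?thesis using p_le[OF that] by (simp add: algebra_simps)
  qed
  have "((\<lambda>t. e + exp (-4 * t) * C) \<longlongrightarrow> e + 0) at_top"
    by (intro tendsto_add tendsto_const tendsto_mult_left_zero filterlim_compose[OF exp_at_bot] 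
        filterlim_tendsto_neg_mult_at_bot[OF tendsto_const] filterlim_ident) auto
  then have "e + 0 \<le> 0"
    by (rule tendsto_le[OF trivial_limit_at_top_linorder lim])
      (rule eventually_mono[OF eventually_ge_at_top[of x] lower])
  then show False using e by simp
qed

text \<open>Factoring d^2/dx^2 - 4 gives the modes p = f' + 2f and q = f' - 2f. As p + q = 2f',
  growth control of f' alone suffices. Reflection x -> -x exchanges the two modes, and a change of
  sign gives the lower bounds.\<close>

lemma bounded_of_ode:
  fixes f f1 :: "real \<Rightarrow> real"
  assumes f: "\<And>x. (f has_real_derivative f1 x) (at x)"
    and f1: "\<And>x. (f1 has_real_derivative 4 * f x - 2 * B x) (at x)"
    and B: "\<And>x. \<bar>B x\<bar> \<le> S"
    and lim: "\<And>s. \<bar>s\<bar> = 1 \<Longrightarrow> ((\<lambda>t. exp (-2 * t) * f1 (s * t)) \<longlongrightarrow> 0) at_top"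
  shows "\<bar>f x\<bar> \<le> S" "\<bar>f1 x\<bar> \<le> S"
proof -
  define p q where "p x = f1 x + 2 * f x" and "q x = f1 x - 2 * f x" for x
  have p: "(p has_real_derivative 2 * p x - 2 * B x) (at x)" for x
    unfolding p_def by (rule derivative_eq_intros f f1 refl)+ (simp add: algebra_simps)
  have q: "(q has_real_derivative - 2 * q x - 2 * B x) (at x)" for x
    unfolding q_def by (rule derivative_eq_intros f f1 refl)+ (simp add: algebra_simps)
  have lim1: "((\<lambda>t. exp (-2 * t) * (p t + q t)) \<longlongrightarrow> 0) at_top"
    using tendsto_mult_right_zero[OF lim[of 1], of 2] by (simp add: p_def q_def algebra_simps)
  have lim2: "((\<lambda>t. exp (-2 * t) * (p (- t) + q (- t))) \<longlongrightarrow> 0) at_top"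
    using tendsto_mult_right_zero[OF lim[of "-1"], of 2] by (simp add: p_def q_def algebra_simps)
  have "p x \<le> S" by (rule bounded_mode_upper[OF p q B lim1])
  moreover have "- p x \<le> S"
    by (rule bounded_mode_upper[where p = "\<lambda>x. - p x" and q = "\<lambda>x. - q x" and B = "\<lambda>x. - B x"])
      (use B tendsto_minus[OF lim1] in \<open>auto intro!: derivative_eq_intros p q simp: algebra_simps\<close>)
  moreover have dp: "((\<lambda>x. p (- x)) has_real_derivative - (2 * p (- x) - 2 * B (- x))) (at x)"
    and dq: "((\<lambda>x. q (- x)) has_real_derivative - (- 2 * q (- x) - 2 * B (- x))) (at x)" for x
    using p[of "- x"] q[of "- x"] by (simp_all only: DERIV_mirror)
  moreover have "- q (- (- x)) \<le> S"
    by (rule bounded_mode_upper[where p = "\<lambda>x. - q (- x)" and q = "\<lambda>x. - p (- x)" and B = "\<lambda>x. B (- x)"])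
      (use B tendsto_minus[OF lim2] in \<open>auto intro!: derivative_eq_intros dp dq simp: algebra_simps\<close>)
  moreover have "q (- (- x)) \<le> S"
    by (rule bounded_mode_upper[where p = "\<lambda>x. q (- x)" and q = "\<lambda>x. p (- x)" and B = "\<lambda>x. - B (- x)"])
      (use B lim2 in \<open>auto intro!: DERIV_cong[OF dp] DERIV_cong[OF dq] simp: algebra_simps\<close>)
  ultimately show "\<bar>f x\<bar> \<le> S" "\<bar>f1 x\<bar> \<le> S"
    unfolding p_def q_def by auto
qed

subsection \<open>The flow at a fixed spectral parameter\<close>

text \<open>While N increases it stays above \<open>N1\<close>, so its slope cannot become
  nonpositive without jumping over the values between 0 and \<delta>. The slope therefore stays at
  least \<delta>, and N passes the bound \<open>M\<close>.\<close>

lemma bounded_escape_right: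
  fixes N w :: "real \<Rightarrow> real"
  assumes N: "\<And>x. (N has_real_derivative w x) (at x)"
    and cont: "continuous_on UNIV w"
    and gap: "\<And>x. N x \<ge> N1 \<Longrightarrow> \<bar>w x\<bar> \<ge> \<delta>" and "\<delta> > 0"
    and bd: "\<And>x. N x \<le> M"
    and x1: "N x1 \<ge> N1"
  shows "w x1 \<le> 0"
proof (rule ccontr)
  assume "\<not> w x1 \<le> 0"
  then have w1: "w x1 > 0" by simp
  have mono: "N a \<le> N b" if "a \<le> b" "\<And>t. a \<le> t \<Longrightarrow> t < b \<Longrightarrow> w t > 0" for a b
  proof (cases "a = b")
    case False
    with that have "a < b" by simp
    then obtain z where z: "z > a" "z < b" "N b - N a = (b - a) * w z"
      using MVT2[of a b N w] N by blast
    then have "w z > 0" using that by simp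
    then have "(b - a) * w z \<ge> 0" using \<open>a < b\<close> by simp
    then show ?thesis using z by simp
  qed simp
  have wpos: "w x > 0" if "x \<ge> x1" for x
  proof (rule ccontr)
    assume "\<not> w x > 0"
    \<comment> \<open>At the first point \<open>t\<close> of \<open>S\<close>, N is still at least
      \<open>N1\<close>, so w t <= -\<delta>; the intermediate value theorem then puts a zero of
      \<open>w\<close> before \<open>t\<close>.\<close>
    define S where "S = {t \<in> {x1..x}. w t \<in> {..0}}"
    have "closed (w -` {..0})"
      by (rule closed_vimage) (use cont in auto)
    then have "compact ({x1..x} \<inter> w -` {..0})"
      by (intro compact_Int_closed compact_Icc)
    then have "compact S" by (simp add: S_def vimage_def Int_def)
    moreover have "x \<in> S" using that \<open>\<not> w x > 0\<close> by (simp add: S_def)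
    ultimately obtain t where t: "t \<in> S" "\<And>s. s \<in> S \<Longrightarrow> t \<le> s"
      using compact_attains_inf[of S] by auto
    have pos: "w s > 0" if "x1 \<le> s" "s < t" for s
      using t that by (force simp: S_def)
    have "x1 \<le> t" using t by (simp add: S_def)
    then have "N x1 \<le> N t" using pos by (rule mono)
    then have "N t \<ge> N1" using x1 by simp
    moreover have "w t \<le> 0" using t(1) by (simp add: S_def)
    ultimately have "w t \<le> - \<delta>" using gap[of t] by simp
    have "\<exists>s\<ge>x1. s \<le> t \<and> w s = 0"
      by (rule IVT2') (use \<open>w t \<le> - \<delta>\<close> \<open>\<delta> > 0\<close> w1 \<open>x1 \<le> t\<close> in \<open>auto intro: continuous_on_subset[OF cont]\<close>)
    then obtain s where s: "x1 \<le> s" "s \<le> t" "w s = 0" by blast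
    then have "s < t" using \<open>w t \<le> - \<delta>\<close> \<open>\<delta> > 0\<close> by (cases "s = t") auto
    then show False using pos[of s] s by simp
  qed
  \<comment> \<open>An interval of this length forces a rise of at least M - N1 + \<delta>, more
    than is available.\<close>
  define L where "L = (M - N1) / \<delta> + 1"
  have "M \<ge> N1" using bd[of x1] x1 by simp
  then have "L > 0" using \<open>\<delta> > 0\<close> by (simp add: L_def add_nonneg_pos)
  then obtain z where z: "z > x1" "z < x1 + L" "N (x1 + L) - N x1 = L * w z"
    using MVT2[of x1 "x1 + L" N w] N by auto
  have "N x1 \<le> N z" using z wpos by (intro mono) auto
  then have "N z \<ge> N1" using x1 by simp
  then have "w z \<ge> \<delta>" using gap[of z] wpos[of z] z by simp
  then have "L * w z \<ge> L * \<delta>" using \<open>L > 0\<close> by simp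
  moreover have "L * \<delta> = M - N1 + \<delta>" using \<open>\<delta> > 0\<close> by (simp add: L_def field_simps)
  ultimately show False using z bd[of "x1 + L"] x1 \<open>\<delta> > 0\<close> by linarith
qed

text \<open>The one-sided version and its mirror image leave only w x = 0, which \<open>gap\<close>
  excludes.\<close>

lemma bounded_escape:
  fixes N w :: "real \<Rightarrow> real"
  assumes N: "\<And>x. (N has_real_derivative w x) (at x)"
    and cont: "continuous_on UNIV w"
    and gap: "\<And>x. N x \<ge> N1 \<Longrightarrow> \<bar>w x\<bar> \<ge> \<delta>" and "\<delta> > 0"
    and bd: "\<And>x. N x \<le> M"
  shows "N x < N1"
proof (rule ccontr)
  assume "\<not> N x < N1"
  then have x: "N x \<ge> N1" by simp
  have "w x \<le> 0"
    by (rule bounded_escape_right[OF N cont gap \<open>\<delta> > 0\<close> bd x])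
  moreover have "- w (- (- x)) \<le> 0"
  proof (rule bounded_escape_right[where N = "\<lambda>x. N (- x)" and w = "\<lambda>x. - w (- x)" and \<delta> = \<delta>
        and M = M and ?N1.0 = N1])
    show "((\<lambda>x. N (- x)) has_real_derivative - w (- x)) (at x)" for x
      using DERIV_mirror[of "N" "w (- x)" x] N[of "- x"] by (auto intro!: derivative_eq_intros DERIV_chain2[OF N])
    show "continuous_on UNIV (\<lambda>x. - w (- x))"
      by (intro continuous_intros continuous_on_compose2[OF cont]) auto
  qed (use gap bd \<open>\<delta> > 0\<close> x in auto)
  ultimately show False using gap[OF x] \<open>\<delta> > 0\<close> by simp
qed

text \<open>
  At a fixed nonzero spectral parameter z the functions are F, G, V = H/z and their z-derivatives,
  with p = m/z and q = m/z^2 for m = 4u - u''; Q = R/z^2 and P is its z-derivative.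
\<close>

locale triple_flow =
  fixes F G V Fz Gz Vz p q :: "real \<Rightarrow> real" and P Q c M :: real
  assumes dF: "\<And>x. (F has_real_derivative 2 * G x - 2 * F x) (at x)"
    and dG: "\<And>x. (G has_real_derivative p x * F x - V x) (at x)"
    and dV: "\<And>x. (V has_real_derivative 2 * V x - 2 * p x * G x) (at x)"
    and dFz: "\<And>x. (Fz has_real_derivative 2 * Gz x - 2 * Fz x) (at x)"
    and dGz: "\<And>x. (Gz has_real_derivative p x * Fz x - Vz x - q x * F x) (at x)"
    and dVz: "\<And>x. (Vz has_real_derivative 2 * Vz x - 2 * p x * Gz x + 2 * q x * G x) (at x)"
    and Qeq: "\<And>x. (G x)\<^sup>2 + F x * V x = Q"
    and Peq: "\<And>x. 2 * G x * Gz x + Fz x * V x + F x * Vz x = P"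
    and Qpos: "Q > 0"
    and q: "\<And>x. q x \<ge> c" "c > 0" "continuous_on UNIV q"
    and bnd: "\<And>x. \<bar>F x\<bar> \<le> M" "\<And>x. \<bar>G x\<bar> \<le> M" "\<And>x. \<bar>V x\<bar> \<le> M"
      "\<And>x. \<bar>Fz x\<bar> \<le> M" "\<And>x. \<bar>Gz x\<bar> \<le> M" "\<And>x. \<bar>Vz x\<bar> \<le> M"
begin

text \<open>
  N equals F^2 times the product of the z-derivatives of (G - sqrt Q)/F and (G + sqrt Q)/F, the
  logarithmic derivatives of the two Floquet solutions up to a constant; this form has no pole at F = 0.
\<close>

definition N where "N x = (Gz x)\<^sup>2 + Fz x * Vz x - P\<^sup>2 / (4 * Q)"
text \<open>Where F is nonzero this is F^2 times the z-derivative of G/F; like \<open>N\<close>, it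
  is regular at the zeros of F.\<close>

definition T where "T x = F x * Gz x - G x * Fz x"

lemma N_deriv: "(N has_real_derivative - 2 * q x * T x) (at x)"
  unfolding N_def T_def
  by (rule derivative_eq_intros dGz dFz dVz refl)+ (use Qpos in \<open>simp add: algebra_simps power2_eq_square\<close>)

lemma T_deriv: "(T has_real_derivative - 2 * T x - q x * (F x)\<^sup>2 + V x * Fz x - F x * Vz x) (at x)"
  unfolding T_def
  by (rule derivative_eq_intros dF dG dGz dFz refl)+ (simp add: algebra_simps power2_eq_square)

lemma T_continuous: "continuous_on UNIV T"
  by (rule DERIV_continuous_on[OF has_field_derivative_at_within[OF T_deriv]])

text \<open>For the quadratic form G^2 + F V, subtract P/(2Q) times (F, G, V) from (Fz, Gz, Vz). The
  difference is orthogonal to (F, G, V), the form takes the value N at it, and its first entry is Fz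
  - P F/(2Q). Orthogonality then reduces T^2 - N F^2 to Q times the square of that entry.\<close>

lemma T_square: "4 * Q * ((T x)\<^sup>2 - N x * (F x)\<^sup>2) = (P * F x - 2 * Q * Fz x)\<^sup>2"
proof -
  have QN: "4 * Q * N x = 4 * Q * ((Gz x)\<^sup>2 + Fz x * Vz x) - P\<^sup>2"
    using Qpos by (simp add: N_def field_simps)
  have "4 * Q * ((T x)\<^sup>2 - N x * (F x)\<^sup>2)
      = 4 * Q * (T x)\<^sup>2 - (4 * Q * N x) * (F x)\<^sup>2"
    by algebra
  also have "\<dots> = 4 * Q * (T x)\<^sup>2 - (4 * Q * ((Gz x)\<^sup>2 + Fz x * Vz x) - P\<^sup>2) * (F x)\<^sup>2"
    using QN by simp
  also have "\<dots> = (P * F x - 2 * Q * Fz x)\<^sup>2"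
    unfolding Qeq[of x, symmetric] Peq[of x, symmetric] T_def by algebra
  finally show ?thesis .
qed

text \<open>The form G^2 + F V is symmetric in F and V, so the identity \<open>T_square\<close>
  persists when they are exchanged.\<close>

lemma TV_square:
  "4 * Q * ((V x * Gz x - G x * Vz x)\<^sup>2 - N x * (V x)\<^sup>2) = (P * V x - 2 * Q * Vz x)\<^sup>2"
proof -
  have QN: "4 * Q * N x = 4 * Q * ((Gz x)\<^sup>2 + Fz x * Vz x) - P\<^sup>2"
    using Qpos by (simp add: N_def field_simps)
  have "4 * Q * ((V x * Gz x - G x * Vz x)\<^sup>2 - N x * (V x)\<^sup>2)
      = 4 * Q * (V x * Gz x - G x * Vz x)\<^sup>2 - (4 * Q * N x) * (V x)\<^sup>2"
    by algebra
  also have "\<dots> = 4 * Q * (V x * Gz x - G x * Vz x)\<^sup>2 - (4 * Q * ((Gz x)\<^sup>2 + Fz x * Vz x) - P\<^sup>2) * (V x)\<^sup>2"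
    using QN by simp
  also have "\<dots> = (P * V x - 2 * Q * Vz x)\<^sup>2"
    unfolding Qeq[of x, symmetric] Peq[of x, symmetric] by algebra
  finally show ?thesis .
qed

lemma M_nonneg: "0 \<le> M" using bnd(1)[of 0] by linarith

text \<open>When P and Q are eliminated, the term 4 G^2 Gz^2 cancels. Apart from a negative square,
  every remaining term contains F or Fz; three of them, each with coefficient 4, are estimated by
  Fz.\<close>

lemma N_le_F_Fz: "4 * Q * N x \<le> 12 * M ^ 3 * (\<bar>F x\<bar> + \<bar>Fz x\<bar>)"
proof -
  have tri: "a * b * c * d \<le> M ^ 3 * \<bar>d\<bar>"
    if "\<bar>a\<bar> \<le> M" "\<bar>b\<bar> \<le> M" "\<bar>c\<bar> \<le> M" for a b c d :: real
  proof -
    have "a * b * c * d \<le> \<bar>a\<bar> * \<bar>b\<bar> * \<bar>c\<bar> * \<bar>d\<bar>" by (metis abs_ge_self abs_mult)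
    also have "\<dots> \<le> M * M * M * \<bar>d\<bar>"
      using that M_nonneg by (intro mult_mono mult_nonneg_nonneg) auto
    finally show ?thesis by (simp add: power3_eq_cube)
  qed
  have "4 * Q * N x = 4 * Q * ((Gz x)\<^sup>2 + Fz x * Vz x) - P\<^sup>2"
    using Qpos by (simp add: N_def field_simps)
  also have "\<dots> = 4 * (Gz x * Gz x * V x * F x) + 4 * (- G x * Gz x * V x * Fz x)
      + 4 * (- G x * Gz x * Vz x * F x) + 4 * (G x * G x * Vz x * Fz x)
      + 4 * (F x * V x * Vz x * Fz x) - (Fz x * V x + F x * Vz x)\<^sup>2"
    unfolding Qeq[of x, symmetric] Peq[of x, symmetric] by algebra
  also have "\<dots> \<le> 12 * M ^ 3 * (\<bar>F x\<bar> + \<bar>Fz x\<bar>)"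
  proof -
    have "Gz x * Gz x * V x * F x \<le> M ^ 3 * \<bar>F x\<bar>" "- G x * Gz x * V x * Fz x \<le> M ^ 3 * \<bar>Fz x\<bar>"
      "- G x * Gz x * Vz x * F x \<le> M ^ 3 * \<bar>F x\<bar>" "G x * G x * Vz x * Fz x \<le> M ^ 3 * \<bar>Fz x\<bar>"
      "F x * V x * Vz x * Fz x \<le> M ^ 3 * \<bar>Fz x\<bar>"
      by (rule tri; use bnd[of x] in simp)+
    moreover have "M ^ 3 * \<bar>F x\<bar> \<ge> 0" using M_nonneg by simp
    moreover have "(Fz x * V x + F x * Vz x)\<^sup>2 \<ge> 0" by simp
    ultimately show ?thesis unfolding distrib_left mult.assoc by linarith
  qed
  finally show ?thesis .
qed

text \<open>A small T would make F small, since N F^2 <= T^2, then Fz small, since (P F - 2 Q Fz)^2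
  <= 4 Q T^2, and finally N small by \<open>N_le_F_Fz\<close>.\<close>

lemma T_lower:
  assumes "N1 > 0"
  obtains \<delta> where "\<delta> > 0" "\<And>x. N x \<ge> N1 \<Longrightarrow> \<bar>T x\<bar> \<ge> \<delta>"
proof -
  \<comment> \<open>\<open>C\<close> is the constant in |F| + |Fz| <= C |T|, valid where N >= N1;
    the summand 1 in \<open>D\<close> keeps the later divisor positive.\<close>
  define C where "C = (1 + \<bar>P\<bar> / (2 * Q)) / sqrt N1 + 1 / sqrt Q"
  have "C \<ge> 0" using Qpos assms by (simp add: C_def)
  define D where "D = 12 * M ^ 3 * C + 1"
  have "D > 0" using \<open>C \<ge> 0\<close> M_nonneg by (simp add: D_def add_nonneg_pos)
  show ?thesis
  proof (rule that[of "4 * Q * N1 / D"])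
    show "4 * Q * N1 / D > 0" using Qpos assms \<open>D > 0\<close> by simp
    fix x assume N: "N x \<ge> N1"
    have sq: "(P * F x - 2 * Q * Fz x)\<^sup>2 \<ge> 0" by simp
    have "4 * Q * (N x * (F x)\<^sup>2) \<le> 4 * Q * (T x)\<^sup>2"
      using T_square[of x] sq unfolding right_diff_distrib by linarith
    then have "N x * (F x)\<^sup>2 \<le> (T x)\<^sup>2" using Qpos by simp
    moreover have "N1 * (F x)\<^sup>2 \<le> N x * (F x)\<^sup>2" using N by (intro mult_right_mono) auto
    ultimately have "sqrt (N1 * (F x)\<^sup>2) \<le> sqrt ((T x)\<^sup>2)"
      by (intro real_sqrt_le_mono) simp
    then have "sqrt N1 * \<bar>F x\<bar> \<le> \<bar>T x\<bar>" by (simp add: real_sqrt_mult)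
    then have F: "\<bar>F x\<bar> \<le> \<bar>T x\<bar> / sqrt N1" using assms by (simp add: field_simps)
    have "0 \<le> N x * (F x)\<^sup>2" using N assms by simp
    then have "0 \<le> 4 * Q * (N x * (F x)\<^sup>2)" using Qpos by simp
    then have "(P * F x - 2 * Q * Fz x)\<^sup>2 \<le> 4 * Q * (T x)\<^sup>2"
      using T_square[of x] unfolding right_diff_distrib by linarith
    then have "sqrt ((P * F x - 2 * Q * Fz x)\<^sup>2) \<le> sqrt (4 * Q * (T x)\<^sup>2)"
      by (rule real_sqrt_le_mono)
    then have "\<bar>P * F x - 2 * Q * Fz x\<bar> \<le> 2 * sqrt Q * \<bar>T x\<bar>" by (simp add: real_sqrt_mult)
    then have "\<bar>2 * Q * Fz x\<bar> \<le> \<bar>P * F x\<bar> + 2 * sqrt Q * \<bar>T x\<bar>" by linarith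
    then have "2 * Q * \<bar>Fz x\<bar> \<le> \<bar>P\<bar> * \<bar>F x\<bar> + 2 * sqrt Q * \<bar>T x\<bar>" 
      using Qpos by (simp add: abs_mult)
    then have "\<bar>Fz x\<bar> \<le> (\<bar>P\<bar> * \<bar>F x\<bar> + 2 * sqrt Q * \<bar>T x\<bar>) / (2 * Q)"
      using Qpos by (simp add: field_simps)
    also have "\<dots> = \<bar>P\<bar> / (2 * Q) * \<bar>F x\<bar> + 1 / sqrt Q * \<bar>T x\<bar>"
    proof -
      have "sqrt Q / Q = 1 / sqrt Q" using Qpos by (simp add: real_div_sqrt field_simps)
      then have "2 * sqrt Q * \<bar>T x\<bar> / (2 * Q) = 1 / sqrt Q * \<bar>T x\<bar>"
        by (metis mult_divide_mult_cancel_left_if mult.assoc times_divide_eq_left zero_neq_numeral)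
      then show ?thesis by (simp add: add_divide_distrib)
    qed
    finally have "\<bar>F x\<bar> + \<bar>Fz x\<bar> \<le> (1 + \<bar>P\<bar> / (2 * Q)) * \<bar>F x\<bar> + 1 / sqrt Q * \<bar>T x\<bar>"
      by (simp add: algebra_simps)
    also have "\<dots> \<le> (1 + \<bar>P\<bar> / (2 * Q)) * (\<bar>T x\<bar> / sqrt N1) + 1 / sqrt Q * \<bar>T x\<bar>"
      using F Qpos by (intro add_right_mono mult_left_mono) auto
    also have "\<dots> = C * \<bar>T x\<bar>" by (simp add: C_def algebra_simps)
    finally have "12 * M ^ 3 * (\<bar>F x\<bar> + \<bar>Fz x\<bar>) \<le> 12 * M ^ 3 * (C * \<bar>T x\<bar>)"
      using M_nonneg by (intro mult_left_mono) auto
    moreover have "4 * Q * N1 \<le> 4 * Q * N x" using N Qpos by simp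
    ultimately have "4 * Q * N1 \<le> D * \<bar>T x\<bar>"
      using N_le_F_Fz[of x] by (simp add: D_def algebra_simps)
    then show "4 * Q * N1 / D \<le> \<bar>T x\<bar>" using \<open>D > 0\<close> by (simp add: field_simps)
  qed
qed

text \<open>With the positive value N x itself as the threshold, |N'| = 2 q |T| is bounded below
  wherever N reaches it, while N is bounded above. \<open>bounded_escape\<close> turns this into N x
  < N x.\<close>

lemma N_nonpos: "N x \<le> 0"
proof (rule ccontr)
  assume "\<not> N x \<le> 0"
  then have "N x > 0" by simp
  then obtain \<delta> where \<delta>: "\<delta> > 0" "\<And>y. N y \<ge> N x \<Longrightarrow> \<bar>T y\<bar> \<ge> \<delta>"
    using T_lower by blast
  have "N x < N x"
  proof (rule bounded_escape[where N = N and ?N1.0 = "N x" and w = "\<lambda>x. - 2 * q x * T x" and \<delta> = "2 * c * \<delta>" and M = "12 * M ^ 3 * (M + M) / (4 * Q)"])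
    show "(N has_real_derivative - 2 * q x * T x) (at x)" for x by (rule N_deriv)
    show "continuous_on UNIV (\<lambda>x. - 2 * q x * T x)"
      by (intro continuous_intros T_continuous q)
    show "2 * c * \<delta> \<le> \<bar>- 2 * q y * T y\<bar>" if "N x \<le> N y" for y
    proof -
      have "c * \<delta> \<le> q y * \<bar>T y\<bar>"
        using \<delta> that q(1)[of y] q(2) by (intro mult_mono) auto
      then show ?thesis using q(1)[of y] q(2) by (simp add: abs_mult)
    qed
    show "0 < 2 * c * \<delta>" using \<delta> q by simp
    show "N x \<le> 12 * M ^ 3 * (M + M) / (4 * Q)" for x
    proof -
      have "12 * M ^ 3 * (\<bar>F x\<bar> + \<bar>Fz x\<bar>) \<le> 12 * M ^ 3 * (M + M)"
        using bnd(1,4)[of x] M_nonneg by (intro mult_left_mono) auto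
      then show ?thesis using N_le_F_Fz[of x] Qpos by (simp add: field_simps)
    qed
  qed
  then show False by simp
qed

text \<open>Here T' = - q F^2 < 0, so T is negative just to the right of \<open>x\<close>. There N'
  = -2 q T is positive, and N would rise above 0.\<close>

lemma no_degenerate:
  assumes "N x = 0" "T x = 0" "F x \<noteq> 0" "V x * Fz x = F x * Vz x"
  shows False
proof -
  have "(T has_real_derivative - q x * (F x)\<^sup>2) (at x)"
    using T_deriv[of x] assms by simp
  moreover have "- q x * (F x)\<^sup>2 < 0"
    using q(1)[of x] q(2) assms by (simp add: mult_neg_pos)
  ultimately obtain d where d: "d > 0" "\<And>h. 0 < h \<Longrightarrow> h < d \<Longrightarrow> T (x + h) < T x"
    using DERIV_neg_dec_right[of T] by blast
  obtain z where z: "z > x" "z < x + d / 2" "N (x + d / 2) - N x = (d / 2) * (- 2 * q z * T z)"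
    using MVT2[of x "x + d / 2" N "\<lambda>x. - 2 * q x * T x"] N_deriv d by auto
  have "T z < 0" using d(2)[of "z - x"] z d(1) assms by simp
  moreover have "q z > 0" using q(1)[of z] q(2) by simp
  ultimately have "(d / 2) * (- 2 * q z * T z) > 0"
    using d by (simp add: mult_pos_neg)
  then show False using z N_nonpos[of "x + d / 2"] assms by simp
qed

text \<open>Equality means that Q/F^2, as a function of z, has a critical point. By
  \<open>T_square\<close> and N <= 0 it forces T = N = 0. Then (Fz, Gz, Vz) is \<open>r\<close>
  times (F, G, V), which \<open>no_degenerate\<close> excludes.\<close>

lemma F_log_derivative:
  assumes "F x \<noteq> 0" shows "P * F x \<noteq> 2 * Q * Fz x"
proof
  assume e: "P * F x = 2 * Q * Fz x"
  then have "(T x)\<^sup>2 = N x * (F x)\<^sup>2" using T_square[of x] Qpos by simp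
  moreover have "N x * (F x)\<^sup>2 \<le> 0" using N_nonpos[of x] by (simp add: mult_nonpos_nonneg)
  ultimately have T0: "T x = 0" by (metis power2_less_eq_zero_iff)
  with \<open>(T x)\<^sup>2 = _\<close> assms have N0: "N x = 0" by simp
  define r where "r = Fz x / F x"
  have Fz: "Fz x = r * F x" using assms by (simp add: r_def)
  have "F x * Gz x = F x * (r * G x)" using T0 unfolding T_def Fz by algebra
  then have Gz: "Gz x = r * G x" using assms mult_left_cancel by blast
  have "P * F x = (2 * r * Q) * F x" using e unfolding Fz by algebra
  then have P: "P = 2 * r * Q" using assms mult_right_cancel by blast
  have "F x * Vz x = P - 2 * G x * (r * G x) - r * F x * V x"
    using Peq[of x] unfolding Fz Gz by (simp add: mult.commute)
  also have "\<dots> = F x * (r * V x)"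
    unfolding P Qeq[of x, symmetric] by algebra
  finally have "F x * Vz x = F x * (r * V x)" .
  then have "Vz x = r * V x" using assms by simp
  then have "V x * Fz x = F x * Vz x" unfolding Fz by simp
  then show False by (rule no_degenerate[OF N0 T0 assms])
qed

text \<open>The argument of \<open>F_log_derivative\<close> with V in place of F.
  \<open>no_degenerate\<close> still asks for F nonzero: since Fz = r F, a zero of F would be a zero
  of Fz too, against \<open>FFz\<close>.\<close>

lemma V_log_derivative:
  assumes "V x \<noteq> 0" and FFz: "F x = 0 \<Longrightarrow> Fz x \<noteq> 0"
  shows "P * V x \<noteq> 2 * Q * Vz x"
proof
  assume e: "P * V x = 2 * Q * Vz x"
  then have s: "(V x * Gz x - G x * Vz x)\<^sup>2 = N x * (V x)\<^sup>2" using TV_square[of x] Qpos by simp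
  moreover have "N x * (V x)\<^sup>2 \<le> 0" using N_nonpos[of x] by (simp add: mult_nonpos_nonneg)
  ultimately have T0: "V x * Gz x - G x * Vz x = 0" by (metis power2_less_eq_zero_iff)
  with s assms have N0: "N x = 0" by simp
  define r where "r = Vz x / V x"
  have Vz: "Vz x = r * V x" using assms by (simp add: r_def)
  have "V x * Gz x = V x * (r * G x)" using T0 unfolding Vz by algebra
  then have Gz: "Gz x = r * G x" using assms mult_left_cancel by blast
  have "P * V x = (2 * r * Q) * V x" using e unfolding Vz by algebra
  then have P: "P = 2 * r * Q" using assms mult_right_cancel by blast
  have "V x * Fz x = P - 2 * G x * (r * G x) - r * V x * F x"
    using Peq[of x] unfolding Vz Gz by (simp add: mult.commute)
  also have "\<dots> = V x * (r * F x)"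
    unfolding P Qeq[of x, symmetric] by algebra
  finally have "V x * Fz x = V x * (r * F x)" .
  then have Fz: "Fz x = r * F x" using assms by simp
  then have "F x \<noteq> 0" using FFz by auto
  moreover have "T x = 0" by (simp add: T_def Gz Fz)
  ultimately show False
    using no_degenerate[OF N0] Fz Vz by simp
qed

end

subsection \<open>Bounded functions and polynomial sums\<close>

definition bdd_fun :: "(real \<Rightarrow> real) \<Rightarrow> bool" where
  "bdd_fun h \<longleftrightarrow> (\<exists>M. \<forall>x. \<bar>h x\<bar> \<le> M)"

lemma bdd_funI: "(\<And>x. \<bar>h x\<bar> \<le> M) \<Longrightarrow> bdd_fun h"
  by (auto simp: bdd_fun_def)

lemma bdd_fun_const [simp]: "bdd_fun (\<lambda>x. c)"
  by (rule bdd_funI[of _ "\<bar>c\<bar>"]) simp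

lemma bdd_fun_add:
  assumes "bdd_fun f" "bdd_fun g" shows "bdd_fun (\<lambda>x. f x + g x)"
proof -
  from assms obtain A B where "\<And>x. \<bar>f x\<bar> \<le> A" "\<And>x. \<bar>g x\<bar> \<le> B" by (auto simp: bdd_fun_def)
  then show ?thesis by (intro bdd_funI[of _ "A + B"]) (meson abs_triangle_ineq add_mono order_trans)
qed

lemma bdd_fun_mult:
  assumes "bdd_fun f" "bdd_fun g" shows "bdd_fun (\<lambda>x. f x * g x)"
proof -
  from assms obtain A B where AB: "\<And>x. \<bar>f x\<bar> \<le> A" "\<And>x. \<bar>g x\<bar> \<le> B" by (auto simp: bdd_fun_def)
  have "\<bar>f x * g x\<bar> \<le> A * B" for x
    unfolding abs_mult using AB[of x] by (intro mult_mono) auto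
  then show ?thesis by (rule bdd_funI)
qed

lemma bdd_fun_diff: "bdd_fun f \<Longrightarrow> bdd_fun g \<Longrightarrow> bdd_fun (\<lambda>x. f x - g x)"
  using bdd_fun_add[OF _ bdd_fun_mult[OF bdd_fun_const[of "-1"]], of f g] by simp

lemma bdd_fun_divide: "bdd_fun f \<Longrightarrow> bdd_fun (\<lambda>x. f x / c)"
  using bdd_fun_mult[OF _ bdd_fun_const[of "inverse c"], of f] by (simp add: divide_inverse)

lemma bdd_fun_sum: "(\<And>i. i \<in> I \<Longrightarrow> bdd_fun (f i)) \<Longrightarrow> bdd_fun (\<lambda>x. \<Sum>i\<in>I. f i x)"
  by (induction I rule: infinite_finite_induct) (auto intro: bdd_fun_add)

section \<open>Polynomials given by coefficient sums\<close>

lemma coeff_sum_monom: "coeff (\<Sum>l\<le>n. monom (a l) l) i = (if i \<le> n then a i else 0)"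
proof -
  have "coeff (\<Sum>l\<le>n. monom (a l) l) i = (\<Sum>l\<le>n. if l = i then a l else 0)"
    by (simp add: coeff_sum)
  also have "\<dots> = (if i \<le> n then a i else 0)"
    by simp
  finally show ?thesis .
qed

lemma poly_sum_monom:
  fixes a :: "nat \<Rightarrow> 'a::comm_semiring_1"
  shows "poly (\<Sum>l\<le>n. monom (a l) l) w = (\<Sum>l\<le>n. a l * w ^ l)"
  by (simp add: poly_sum poly_monom)

lemma rev_sum_eval:
  fixes a :: "nat \<Rightarrow> 'a::field"
  assumes "w \<noteq> 0"
  shows "w ^ n * (\<Sum>l\<le>n. a (n - l) * (1 / w) ^ l) = (\<Sum>l\<le>n. a l * w ^ l)"
proof -
  have "w ^ n * (\<Sum>l\<le>n. a (n - l) * (1 / w) ^ l) = (\<Sum>l\<le>n. a (n - l) * w ^ (n - l))"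
    unfolding sum_distrib_left
    by (rule sum.cong) (use assms in \<open>auto simp: power_diff power_divide\<close>)
  also have "\<dots> = (\<Sum>l\<le>n. a l * w ^ l)"
    by (rule sum.reindex_bij_witness[of _ "\<lambda>i. n - i" "\<lambda>i. n - i"]) auto
  finally show ?thesis .
qed

text \<open>The difference of the two sides has degree below \<open>n\<close> but \<open>n\<close>
  distinct roots. The leading coefficient may vanish, so the lemma applies to H without a discussion
  of h_0.\<close>

lemma sum_power_eq_prod_roots:
  fixes a :: "nat \<Rightarrow> 'a::field"
  assumes roots: "\<And>j. j \<in> {1..n} \<Longrightarrow> (\<Sum>l\<le>n. a l * r j ^ l) = 0" and inj: "inj_on r {1..n}"
  shows "(\<Sum>l\<le>n. a l * z ^ l) = a n * (\<Prod>j\<in>{1..n}. z - r j)"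
proof -
  define s where "s = (\<Prod>j\<in>{1..n}. [:- r j, 1:])"
  define q where "q = (\<Sum>l\<le>n. monom (a l) l) - smult (a n) s"
  have lead: "lead_coeff s = 1" unfolding s_def by (simp add: lead_coeff_prod)
  have deg: "degree s = n" unfolding s_def by (subst degree_prod_eq_sum_degree) auto
  have evs: "poly s w = (\<Prod>j\<in>{1..n}. w - r j)" for w by (simp add: s_def poly_prod)
  have "q = 0"
  proof (rule ccontr)
    assume "q \<noteq> 0"
    have "coeff q i = 0" if "i \<ge> n" for i
      using that lead deg by (cases "i = n") (auto simp: q_def coeff_sum_monom coeff_eq_0)
    then have "degree q < n \<or> q = 0"
      by (metis leading_coeff_0_iff not_le)
    with \<open>q \<noteq> 0\<close> have "degree q < n" by simp
    have "poly q (r j) = 0" if "j \<in> {1..n}" for j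
    proof -
      have "(\<Prod>i\<in>{1..n}. r j - r i) = 0" using that by (intro prod_zero) auto
      then show ?thesis using roots[OF that] by (simp add: q_def poly_sum_monom evs)
    qed
    then have "r ` {1..n} \<subseteq> {x. poly q x = 0}" by auto
    then have "card (r ` {1..n}) \<le> card {x. poly q x = 0}"
      using poly_roots_finite[OF \<open>q \<noteq> 0\<close>] by (rule card_mono[rotated])
    also have "\<dots> \<le> degree q" using card_poly_roots_bound[OF \<open>q \<noteq> 0\<close>] .
    finally show False using \<open>degree q < n\<close> card_image[OF inj] by simp
  qed
  then have "poly q z = 0" by simp
  then show ?thesis by (simp add: q_def poly_sum_monom evs)
qed

lemma has_deriv_prod_at_root:
  fixes r :: "'i \<Rightarrow> real"
  assumes "finite A" "k \<in> A"
  shows "((\<lambda>z. \<Prod>j\<in>A. z - r j) has_real_derivative (\<Prod>j\<in>A - {k}. r k - r j)) (at (r k))"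
proof -
  have "(\<lambda>z. \<Prod>j\<in>A. z - r j) = (\<lambda>z. (z - r k) * (\<Prod>j\<in>A - {k}. z - r j))"
    using assms by (auto simp: prod.remove)
  moreover have "\<exists>d. ((\<lambda>z. \<Prod>j\<in>A - {k}. z - r j) has_real_derivative d) (at (r k))"
    by (rule exI, rule has_field_derivative_prod) (auto intro!: derivative_eq_intros)
  then obtain d where "((\<lambda>z. \<Prod>j\<in>A - {k}. z - r j) has_real_derivative d) (at (r k))" ..
  then have "((\<lambda>z. (z - r k) * (\<Prod>j\<in>A - {k}. z - r j)) has_real_derivative (\<Prod>j\<in>A - {k}. r k - r j)) (at (r k))"
    by (auto intro!: derivative_eq_intros)
  ultimately show ?thesis by simp
qed

lemma has_deriv_sum_power:
  fixes a :: "nat \<Rightarrow> real"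
  shows "((\<lambda>z. \<Sum>l\<le>n. a l * z ^ l) has_real_derivative (\<Sum>l\<le>n. a l * (real l * z ^ (l - 1)))) (at z)"
  by (auto intro!: derivative_eq_intros sum.cong)

text \<open>Recovers at z = 0 an identity that was obtained after division by z.\<close>

lemma continuous_zero_at:
  fixes D :: "real \<Rightarrow> real"
  assumes "isCont D a" "\<And>z. z \<noteq> a \<Longrightarrow> D z = 0"
  shows "D a = 0"
proof -
  have "D \<midarrow>a\<rightarrow> 0"
    by (rule tendsto_eventually) (use assms(2) in \<open>auto simp: eventually_at intro: exI[of _ 1]\<close>)
  then show ?thesis using assms(1) LIM_unique unfolding isCont_def by blast
qed

subsection \<open>The coefficients of F, G and H\<close>

locale stationary_CH =
  fixes u :: "real \<Rightarrow> real" and n :: nat and f :: "nat \<Rightarrow> real \<Rightarrow> real" and E :: "nat \<Rightarrow> real"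
  assumes smooth: "C_inf u"
    and bdd: "\<forall>k\<le>2. bounded (range ((deriv ^^ k) u))"
    and pos: "\<forall>x. 4 * u x - deriv (deriv u) x > 0"
    and fseq: "is_f_seq u n f"
    and stat: "\<forall>x. sCH u n f x = 0"
    and Rform: "\<forall>(z::complex) x. z\<^sup>2 * (Gpol n f z x)\<^sup>2 + z * Fpol n f z x * Hpol u n f z x
                   = (\<Prod>m<2*n+2. z - of_real (E m))"
    and Eord: "\<forall>m<2*n+1. E m < E (m + 1)"
    and Elast: "E (2*n+1) = 0"
begin

abbreviation g where "g \<equiv> gg f"
abbreviation h where "h \<equiv> hh u n f"

definition m where "m x = 4 * u x - deriv (deriv u) x"

lemma m_smooth: "C_inf m"
  unfolding m_def using smooth by (intro C_inf_arith C_inf_cmult C_inf_deriv)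

lemma m_pos: "m x > 0" using pos by (simp add: m_def)

lemma m_deriv: "deriv m = (\<lambda>x. 4 * deriv u x - (deriv ^^ 3) u x)"
proof (rule deriv_eqI)
  fix x
  have "(u has_real_derivative deriv u x) (at x)"
    "(deriv (deriv u) has_real_derivative deriv (deriv (deriv u)) x) (at x)"
    using smooth by (auto intro!: C_inf_has_deriv C_inf_deriv)
  then show "(m has_real_derivative 4 * deriv u x - (deriv ^^ 3) u x) (at x)"
    unfolding m_def by (auto intro!: derivative_eq_intros simp: numeral_3_eq_3)
qed

lemma CH_arg_eq: "CH_arg u k = (\<lambda>y. 2 * m y * deriv k y + deriv m y * k y)"
  by (rule ext) (simp add: CH_arg_def m_deriv m_def)

lemma f_0: "f 0 = (\<lambda>x. 1)" using fseq by (simp add: is_f_seq_def)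

lemma f_int: "l < n \<Longrightarrow> integrable lborel (\<lambda>y. exp (-2 * \<bar>x - y\<bar>) * CH_arg u (f l) y)"
  using fseq unfolding is_f_seq_def by (auto dest!: bspec[of _ _ "Suc l"])

lemma f_Suc_deriv: "l < n \<Longrightarrow> (f (Suc l) has_real_derivative -2 * Gop (CH_arg u (f l)) x) (at x)"
  using fseq unfolding is_f_seq_def by (auto dest!: bspec[of _ _ "Suc l"])

lemma CH_arg_smooth: "C_inf k \<Longrightarrow> C_inf (CH_arg u k)"
  unfolding CH_arg_eq using m_smooth by (intro C_inf_arith C_inf_cmult C_inf_deriv)

text \<open>\<open>is_f_seq\<close> prescribes only first derivatives. Smoothness is inherited along
  the recursion, since \<open>Gop\<close> of a smooth function solves an equation to which
  \<open>C_inf_ode2\<close> applies.\<close>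

lemma f_smooth: "l \<le> n \<Longrightarrow> C_inf (f l)"
proof (induction l)
  case 0
  then show ?case by (simp add: f_0 C_inf_iff_ksmooth ksmooth_const)
next
  case (Suc l)
  then have v: "C_inf (CH_arg u (f l))" by (intro CH_arg_smooth) simp
  have l: "l < n" using Suc.prems by simp
  obtain w1 where w: "\<And>x. (Gop (CH_arg u (f l)) has_real_derivative w1 x) (at x)"
    "\<And>x. (w1 has_real_derivative 4 * Gop (CH_arg u (f l)) x - CH_arg u (f l) x) (at x)"
    using Gop_ode[OF C_inf_continuous_on[OF v] f_int[OF l]] by blast
  have "C_inf (Gop (CH_arg u (f l)))" by (rule C_inf_ode2[OF w v])
  then show ?case by (intro C_infI[OF f_Suc_deriv[OF l]] C_inf_cmult)
qed

lemma f_has_deriv: "l \<le> n \<Longrightarrow> (f l has_real_derivative deriv (f l) x) (at x)"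
  by (intro C_inf_has_deriv f_smooth)

text \<open>The local form of the recursion, obtained by applying -d^2/dx^2 + 4 to it.\<close>

lemma f_Suc_third:
  assumes l: "l < n"
  shows "(deriv (deriv (f (Suc l))) has_real_derivative
    4 * deriv (f (Suc l)) x + 2 * (2 * m x * deriv (f l) x + deriv m x * f l x)) (at x)"
proof -
  have v: "C_inf (CH_arg u (f l))" using l by (intro CH_arg_smooth f_smooth) simp
  obtain w1 where w: "\<And>x. (Gop (CH_arg u (f l)) has_real_derivative w1 x) (at x)"
    "\<And>x. (w1 has_real_derivative 4 * Gop (CH_arg u (f l)) x - CH_arg u (f l) x) (at x)"
    using Gop_ode[OF C_inf_continuous_on[OF v] f_int[OF l]] by blast
  have d1: "deriv (f (Suc l)) = (\<lambda>x. -2 * Gop (CH_arg u (f l)) x)"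
    by (rule deriv_eqI) (rule f_Suc_deriv[OF l])
  have d2: "deriv (deriv (f (Suc l))) = (\<lambda>x. -2 * w1 x)"
    unfolding d1 by (rule deriv_eqI) (rule DERIV_cmult[OF w(1)])
  have "((\<lambda>x. -2 * w1 x) has_real_derivative -2 * (4 * Gop (CH_arg u (f l)) x - CH_arg u (f l) x)) (at x)"
    by (rule DERIV_cmult[OF w(2)])
  then show ?thesis unfolding d2 by (simp add: d1 CH_arg_eq algebra_simps)
qed

text \<open>This is what later excludes the homogeneous solutions exp(2x) and exp(-2x) of f'' =
  4f.\<close>

lemma f_deriv_growth:
  assumes l: "l < n" and s: "\<bar>s\<bar> = 1"
  shows "((\<lambda>t. exp (-2 * t) * deriv (f (Suc l)) (s * t)) \<longlongrightarrow> 0) at_top"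
proof -
  have d1: "deriv (f (Suc l)) = (\<lambda>x. -2 * Gop (CH_arg u (f l)) x)"
    by (rule deriv_eqI) (rule f_Suc_deriv[OF l])
  have "CH_arg u (f l) \<in> borel_measurable borel"
    using l by (intro borel_measurable_continuous_onI C_inf_continuous_on CH_arg_smooth f_smooth) simp
  from tendsto_mult_right_zero[OF Gop_growth[OF f_int[OF l] s this], of "-2"]
  show ?thesis by (simp add: d1 mult_ac)
qed

section \<open>Differential equations for the coefficients\<close>

lemma g_smooth: "l \<le> n \<Longrightarrow> C_inf (g l)"
  using C_inf_arith(1)[OF f_smooth C_inf_cmult[OF C_inf_deriv[OF f_smooth], of _ "1/2"], of l l]
  unfolding gg_def[abs_def] by simp

lemma g_0: "g 0 = (\<lambda>x. 1)"
  by (rule ext) (simp add: gg_def f_0)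

lemma g_has_deriv: "l \<le> n \<Longrightarrow> (g l has_real_derivative deriv (g l) x) (at x)"
  by (intro C_inf_has_deriv g_smooth)

lemma g_deriv_eq: "l \<le> n \<Longrightarrow> deriv (g l) = (\<lambda>x. deriv (f l) x + deriv (deriv (f l)) x / 2)"
proof (rule deriv_eqI)
  fix x assume "l \<le> n"
  then show "(g l has_real_derivative deriv (f l) x + deriv (deriv (f l)) x / 2) (at x)"
    unfolding gg_def[abs_def]
    by (auto intro!: derivative_eq_intros f_has_deriv C_inf_has_deriv C_inf_deriv f_smooth)
qed

lemma h_eq: "l < n \<Longrightarrow> h l x = m x * f l x - deriv (g (Suc l)) x"
  by (simp add: hh_def m_def)

lemma h_n: "h n x = m x * f n x"
  by (simp add: hh_def m_def)

lemma f_flow: "l \<le> n \<Longrightarrow> (f l has_real_derivative 2 * g l x - 2 * f l x) (at x)"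
  using f_has_deriv[of l x] by (simp add: gg_def)

text \<open>For l = n this is the stationary equation; for l < n it is the third-order form of the
  recursion for f_{l+1}.\<close>

lemma h_flow:
  assumes "l \<le> n"
  shows "(h l has_real_derivative 2 * h l x - 2 * m x * g l x) (at x)"
proof (cases "l = n")
  case True
  have "h n = (\<lambda>x. m x * f n x)" by (rule ext) (rule h_n)
  moreover have "((\<lambda>x. m x * f n x) has_real_derivative deriv m x * f n x + deriv (f n) x * m x) (at x)"
    by (rule DERIV_mult[OF C_inf_has_deriv[OF m_smooth] f_has_deriv]) simp
  moreover have "deriv m x * f n x + deriv (f n) x * m x = 2 * h n x - 2 * m x * g n x"
    using stat[rule_format, of x] by (simp add: sCH_def m_deriv m_def h_n gg_def algebra_simps)
  ultimately show ?thesis using True by simp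
next
  case False
  with assms have l: "l < n" by simp
  have hl: "h l = (\<lambda>x. m x * f l x - (deriv (f (Suc l)) x + deriv (deriv (f (Suc l))) x / 2))"
    by (rule ext) (use l in \<open>simp add: h_eq g_deriv_eq\<close>)
  have d: "((\<lambda>x. m x * f l x - (deriv (f (Suc l)) x + deriv (deriv (f (Suc l))) x / 2)) has_real_derivative
      (deriv m x * f l x + deriv (f l) x * m x) - (deriv (deriv (f (Suc l))) x
        + (4 * deriv (f (Suc l)) x + 2 * (2 * m x * deriv (f l) x + deriv m x * f l x)) / 2)) (at x)"
    using l by (intro DERIV_diff DERIV_add DERIV_mult DERIV_cdivide f_Suc_third f_has_deriv
        C_inf_has_deriv C_inf_deriv f_smooth m_smooth) auto
  have v: "(deriv m x * f l x + deriv (f l) x * m x) - (deriv (deriv (f (Suc l))) x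
        + (4 * deriv (f (Suc l)) x + 2 * (2 * m x * deriv (f l) x + deriv m x * f l x)) / 2)
      = 2 * h l x - 2 * m x * g l x"
    using l by (simp add: h_eq g_deriv_eq gg_def field_simps)
  show ?thesis by (rule DERIV_cong[OF d[folded hl] v])
qed

definition R where "R z = (\<Prod>i<2*n+2. z - E i)" for z :: real

lemma R_eq: "z\<^sup>2 * (Gpol n f z x)\<^sup>2 + z * Fpol n f z x * Hpol u n f z x = R z" for z :: real
proof -
  have "Fpol n f (complex_of_real z) x = of_real (Fpol n f z x)"
    "Gpol n f (complex_of_real z) x = of_real (Gpol n f z x)"
    "Hpol u n f (complex_of_real z) x = of_real (Hpol u n f z x)"
    by (simp_all add: Fpol_def Gpol_def Hpol_def)
  then have "complex_of_real (z\<^sup>2 * (Gpol n f z x)\<^sup>2 + z * Fpol n f z x * Hpol u n f z x) = of_real (R z)"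
    using Rform[rule_format, of "of_real z" x] by (simp add: R_def)
  then show ?thesis by (simp only: of_real_eq_iff)
qed

section \<open>Boundedness of the coefficients\<close>

text \<open>The coefficient of w^(j+1) in w^(2n+2) R(1/w) does not depend on x. Because f_0 = g_0 =
  1, it contains 2 g_{j+1} and h_j linearly; the other terms involve only f and g with indices 1 to
  j and h with indices below j.\<close>

lemma coeff_identity:
  assumes j: "j < n"
  obtains C where "\<And>x. 2 * g (Suc j) x + h j x
    = C - (\<Sum>i\<in>{1..j}. g i x * g (Suc j - i) x + f i x * h (j - i) x)"
proof -
  define pF pG pH where "pF x = (\<Sum>l\<le>n. monom (f l x) l)" and "pG x = (\<Sum>l\<le>n. monom (g l x) l)"
    and "pH x = (\<Sum>l\<le>n. monom (h l x) l)" for x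
  define pR where "pR x = pG x * pG x + pCons 0 (pF x * pH x)" for x
  have ev: "poly (pF x) w = w ^ n * Fpol n f (1 / w) x" "poly (pG x) w = w ^ n * Gpol n f (1 / w) x"
    "poly (pH x) w = w ^ n * Hpol u n f (1 / w) x" if "w \<noteq> 0" for w x
    using rev_sum_eval[OF that, of n "\<lambda>l. f l x"] rev_sum_eval[OF that, of n "\<lambda>l. g l x"]
      rev_sum_eval[OF that, of n "\<lambda>l. h l x"]
    by (simp_all add: pF_def pG_def pH_def poly_sum_monom Fpol_def Gpol_def Hpol_def)
  have pR: "poly (pR x) w = w ^ (2 * n + 2) * R (1 / w)" if "w \<noteq> 0" for w x
  proof -
    have "w ^ (2 * n + 2) = w ^ n * w ^ n * w * w" by (simp add: power_add mult_2)
    then show ?thesis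
      unfolding R_eq[of _ x, symmetric] pR_def using that
      by (simp add: ev field_simps power2_eq_square)
  qed
  \<comment> \<open>The formula \<open>pR\<close> is available only for w nonzero; the extra factor
    w settles w = 0.\<close>
  have "pR x * [:0, 1:] = pR 0 * [:0, 1:]" for x
    unfolding poly_eq_poly_eq_iff[symmetric]
  proof
    fix w show "poly (pR x * [:0, 1:]) w = poly (pR 0 * [:0, 1:]) w"
      using pR[of w x] pR[of w 0] by (cases "w = 0") auto
  qed
  then have const: "pR x = pR 0" for x
    by (metis mult_right_cancel one_neq_zero pCons_eq_0_iff)
  have co: "coeff (pR x) (Suc j) = 2 * g (Suc j) x + h j x
      + (\<Sum>i\<in>{1..j}. g i x * g (Suc j - i) x + f i x * h (j - i) x)" for x
  proof -
    have split: "(\<Sum>i\<le>j. t i) = t 0 + (\<Sum>i\<in>{1..j}. t i)" for t :: "nat \<Rightarrow> real"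
      by (simp add: atMost_atLeast0 sum.atLeast_Suc_atMost)
    have "coeff (pG x * pG x) (Suc j) = (\<Sum>i\<le>Suc j. g i x * g (Suc j - i) x)"
      unfolding coeff_mult by (rule sum.cong) (use j in \<open>auto simp: pG_def coeff_sum_monom\<close>)
    also have "\<dots> = 2 * g (Suc j) x + (\<Sum>i\<in>{1..j}. g i x * g (Suc j - i) x)"
      unfolding sum.atMost_Suc split by (simp add: g_0)
    finally have 1: "coeff (pG x * pG x) (Suc j) = 2 * g (Suc j) x + (\<Sum>i\<in>{1..j}. g i x * g (Suc j - i) x)" .
    have "coeff (pF x * pH x) j = (\<Sum>i\<le>j. f i x * h (j - i) x)"
      unfolding coeff_mult by (rule sum.cong) (use j in \<open>auto simp: pF_def pH_def coeff_sum_monom\<close>)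
    also have "\<dots> = h j x + (\<Sum>i\<in>{1..j}. f i x * h (j - i) x)"
      unfolding split by (simp add: f_0)
    finally show ?thesis using 1 by (simp add: pR_def sum.distrib)
  qed
  have "2 * g (Suc j) x + h j x = coeff (pR 0) (Suc j)
      - (\<Sum>i\<in>{1..j}. g i x * g (Suc j - i) x + f i x * h (j - i) x)" for x
    using co[of x] const[of x] by simp
  then show ?thesis by (rule that)
qed

lemma m_bdd: "bdd_fun m"
proof -
  have "bdd_fun ((deriv ^^ k) u)" if "k \<le> 2" for k
    using bdd that by (auto simp: bounded_iff bdd_fun_def)
  from this[of 0] this[of 2] have "bdd_fun u" "bdd_fun (deriv (deriv u))"
    by (simp_all add: numeral_2_eq_2)
  then show ?thesis unfolding m_def[abs_def] by (intro bdd_fun_diff bdd_fun_mult bdd_fun_const)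
qed

text \<open>The bound on h lags one index behind, since h_k involves the derivative of g_{k+1}.
  Inserting h_k = m f_k - g_{k+1}' into \<open>coeff_identity\<close> gives 2g - g' = B for g =
  g_{k+1}, with bounded B. As g = f + f'/2, the first derivatives cancel and f'' = 4f - 2B remains,
  the case of \<open>bounded_of_ode\<close>.\<close>

lemma coeffs_bdd_aux:
  "k \<le> n \<Longrightarrow> (\<forall>i\<le>k. bdd_fun (f i) \<and> bdd_fun (g i)) \<and> (\<forall>i<k. bdd_fun (h i))"
proof (induction k)
  case 0
  then show ?case by (simp add: f_0 g_0)
next
  case (Suc k)
  then have k: "k < n" and IHf: "\<And>i. i \<le> k \<Longrightarrow> bdd_fun (f i)" and IHg: "\<And>i. i \<le> k \<Longrightarrow> bdd_fun (g i)"
    and IHh: "\<And>i. i < k \<Longrightarrow> bdd_fun (h i)" by auto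
  obtain C where C: "\<And>x. 2 * g (Suc k) x + h k x
    = C - (\<Sum>i\<in>{1..k}. g i x * g (Suc k - i) x + f i x * h (k - i) x)"
    using coeff_identity[OF k] by blast
  define B where "B x = C - (\<Sum>i\<in>{1..k}. g i x * g (Suc k - i) x + f i x * h (k - i) x) - m x * f k x" for x
  have bB: "bdd_fun B" unfolding B_def
    using IHf IHg IHh m_bdd by (intro bdd_fun_diff bdd_fun_const bdd_fun_sum bdd_fun_add bdd_fun_mult) auto
  then obtain S where S: "\<And>x. \<bar>B x\<bar> \<le> S" by (auto simp: bdd_fun_def)
  have Beq: "2 * g (Suc k) x - deriv (g (Suc k)) x = B x" for x
    using C[of x] h_eq[OF k, of x] by (simp add: B_def)
  have d2: "deriv (deriv (f (Suc k))) x = 4 * f (Suc k) x - 2 * B x" for x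
    using Beq[of x] k by (simp add: g_deriv_eq gg_def field_simps)
  have f2: "(deriv (f (Suc k)) has_real_derivative 4 * f (Suc k) x - 2 * B x) (at x)" for x
    unfolding d2[symmetric] using k by (intro C_inf_has_deriv C_inf_deriv f_smooth) simp
  have f1: "(f (Suc k) has_real_derivative deriv (f (Suc k)) x) (at x)" for x
    using k by (intro f_has_deriv) simp
  have bf: "bdd_fun (f (Suc k))" "bdd_fun (deriv (f (Suc k)))"
    using bounded_of_ode[OF f1 f2 S f_deriv_growth[OF k]] by (auto intro: bdd_funI)
  have bg: "bdd_fun (g (Suc k))" unfolding gg_def[abs_def]
    using bf by (intro bdd_fun_add bdd_fun_divide)
  have "h k = (\<lambda>x. m x * f k x - (2 * g (Suc k) x - B x))"
    by (rule ext) (use h_eq[OF k] Beq in \<open>simp add: algebra_simps\<close>)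
  moreover have "bdd_fun \<dots>"
    using m_bdd IHf bg bB by (intro bdd_fun_diff bdd_fun_mult bdd_fun_const) auto
  ultimately have "bdd_fun (h k)" by simp
  then show ?case
    using bf bg IHf IHg IHh by (auto simp: le_Suc_eq less_Suc_eq)
qed

lemma coeffs_bdd: "l \<le> n \<Longrightarrow> bdd_fun (f l)" "l \<le> n \<Longrightarrow> bdd_fun (g l)" "l \<le> n \<Longrightarrow> bdd_fun (h l)"
proof -
  have hn: "bdd_fun (h n)"
    using bdd_fun_mult[OF m_bdd, of "f n"] coeffs_bdd_aux[of n] h_n by (simp add: bdd_fun_def)
  show "l \<le> n \<Longrightarrow> bdd_fun (f l)" "l \<le> n \<Longrightarrow> bdd_fun (g l)" "l \<le> n \<Longrightarrow> bdd_fun (h l)"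
    using coeffs_bdd_aux[of n] hn by (auto simp: le_less)
qed

subsection \<open>Zeros in the spectral gaps\<close>

abbreviation F :: "real \<Rightarrow> real \<Rightarrow> real" where "F z x \<equiv> Fpol n f z x"
abbreviation G :: "real \<Rightarrow> real \<Rightarrow> real" where "G z x \<equiv> Gpol n f z x"
abbreviation H :: "real \<Rightarrow> real \<Rightarrow> real" where "H z x \<equiv> Hpol u n f z x"

text \<open>A leading \<open>d\<close> stands for the z-derivative and a trailing \<open>x\<close>
  for the x-derivative. At l = 0 the truncated exponent l - 1 is harmless because the factor
  \<open>real l\<close> vanishes.\<close>

definition dF where "dF z x = (\<Sum>l\<le>n. f (n - l) x * (real l * z ^ (l - 1)))"
definition dG where "dG z x = (\<Sum>l\<le>n. g (n - l) x * (real l * z ^ (l - 1)))"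
definition dH where "dH z x = (\<Sum>l\<le>n. h (n - l) x * (real l * z ^ (l - 1)))"
definition Gx where "Gx z x = (\<Sum>l\<le>n. deriv (g (n - l)) x * z ^ l)"
definition dGx where "dGx z x = (\<Sum>l\<le>n. deriv (g (n - l)) x * (real l * z ^ (l - 1)))"

lemma pol_eqs:
  "F z x = (\<Sum>l\<le>n. f (n - l) x * z ^ l)" "G z x = (\<Sum>l\<le>n. g (n - l) x * z ^ l)"
  "H z x = (\<Sum>l\<le>n. h (n - l) x * z ^ l)"
  by (simp_all add: Fpol_def Gpol_def Hpol_def)

lemma z_derivs:
  "((\<lambda>z. F z x) has_real_derivative dF z x) (at z)"
  "((\<lambda>z. G z x) has_real_derivative dG z x) (at z)"
  "((\<lambda>z. H z x) has_real_derivative dH z x) (at z)"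
  "((\<lambda>z. Gx z x) has_real_derivative dGx z x) (at z)"
  unfolding pol_eqs dF_def dG_def dH_def Gx_def dGx_def by (rule has_deriv_sum_power)+

lemma F_flow: "((\<lambda>x. F z x) has_real_derivative 2 * G z x - 2 * F z x) (at x)"
  and dF_flow: "((\<lambda>x. dF z x) has_real_derivative 2 * dG z x - 2 * dF z x) (at x)"
proof -
  \<comment> \<open>The weights z^l give the first claim and l z^(l-1) the second.\<close>
  have gen: "((\<lambda>x. \<Sum>l\<le>n. f (n - l) x * c l) has_real_derivative
      2 * (\<Sum>l\<le>n. g (n - l) x * c l) - 2 * (\<Sum>l\<le>n. f (n - l) x * c l)) (at x)" for c :: "nat \<Rightarrow> real"
  proof -
    have "((\<lambda>x. \<Sum>l\<le>n. f (n - l) x * c l) has_real_derivative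
        (\<Sum>l\<le>n. (2 * g (n - l) x - 2 * f (n - l) x) * c l)) (at x)"
      by (intro DERIV_sum DERIV_cmult_right f_flow) simp
    also have "(\<Sum>l\<le>n. (2 * g (n - l) x - 2 * f (n - l) x) * c l)
        = 2 * (\<Sum>l\<le>n. g (n - l) x * c l) - 2 * (\<Sum>l\<le>n. f (n - l) x * c l)"
      by (simp add: left_diff_distrib sum_subtractf sum_distrib_left mult.assoc)
    finally show ?thesis .
  qed
  show "((\<lambda>x. F z x) has_real_derivative 2 * G z x - 2 * F z x) (at x)"
    "((\<lambda>x. dF z x) has_real_derivative 2 * dG z x - 2 * dF z x) (at x)"
    unfolding pol_eqs dF_def dG_def by (rule gen)+
qed

lemma H_flow: "((\<lambda>x. H z x) has_real_derivative 2 * H z x - 2 * m x * G z x) (at x)"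
  and dH_flow: "((\<lambda>x. dH z x) has_real_derivative 2 * dH z x - 2 * m x * dG z x) (at x)"
proof -
  have gen: "((\<lambda>x. \<Sum>l\<le>n. h (n - l) x * c l) has_real_derivative
      2 * (\<Sum>l\<le>n. h (n - l) x * c l) - 2 * m x * (\<Sum>l\<le>n. g (n - l) x * c l)) (at x)" for c :: "nat \<Rightarrow> real"
  proof -
    have "((\<lambda>x. \<Sum>l\<le>n. h (n - l) x * c l) has_real_derivative
        (\<Sum>l\<le>n. (2 * h (n - l) x - 2 * m x * g (n - l) x) * c l)) (at x)"
      by (intro DERIV_sum DERIV_cmult_right h_flow) simp
    also have "(\<Sum>l\<le>n. (2 * h (n - l) x - 2 * m x * g (n - l) x) * c l)
        = 2 * (\<Sum>l\<le>n. h (n - l) x * c l) - 2 * m x * (\<Sum>l\<le>n. g (n - l) x * c l)"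
      by (simp add: left_diff_distrib sum_subtractf sum_distrib_left mult.assoc)
    finally show ?thesis .
  qed
  show "((\<lambda>x. H z x) has_real_derivative 2 * H z x - 2 * m x * G z x) (at x)"
    "((\<lambda>x. dH z x) has_real_derivative 2 * dH z x - 2 * m x * dG z x) (at x)"
    unfolding pol_eqs dG_def dH_def by (rule gen)+
qed

lemma G_flow: "((\<lambda>x. G z x) has_real_derivative Gx z x) (at x)"
  and dG_flow: "((\<lambda>x. dG z x) has_real_derivative dGx z x) (at x)"
  unfolding pol_eqs Gx_def dG_def dGx_def
  by (intro DERIV_sum DERIV_cmult_right g_has_deriv; simp)+

text \<open>Multiplication by z shifts the index in g_{i+1}' = m f_i - h_i. The ends match because
  g_0' = 0 and h_n = m f_n.\<close>

lemma Gx_eq: "z * Gx z x = m x * F z x - H z x"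
proof -
  define e where "e i = m x * f i x - h i x" for i
  have e: "e n = 0" "\<And>i. i < n \<Longrightarrow> deriv (g (Suc i)) x = e i" by (simp_all add: e_def h_n h_eq)
  have g0: "deriv (g 0) x = 0" by (simp add: g_0)
  have "z * Gx z x = (\<Sum>l\<le>n. deriv (g (n - l)) x * z ^ Suc l)"
    by (simp add: Gx_def sum_distrib_left mult_ac)
  also have "\<dots> = (\<Sum>l<n. deriv (g (n - l)) x * z ^ Suc l)"
    by (simp add: lessThan_Suc_atMost[symmetric] g0)
  also have "\<dots> = (\<Sum>l<n. e (n - Suc l) * z ^ Suc l)"
  proof (rule sum.cong)
    fix l assume "l \<in> {..<n}"
    then have "n - l = Suc (n - Suc l)" "n - Suc l < n" by auto
    then show "deriv (g (n - l)) x * z ^ Suc l = e (n - Suc l) * z ^ Suc l" using e(2) by simp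
  qed simp
  also have "\<dots> = (\<Sum>l\<le>n. e (n - l) * z ^ l)"
    using e(1) by (simp add: lessThan_Suc_atMost[symmetric] sum.lessThan_Suc_shift del: sum.lessThan_Suc)
  also have "\<dots> = m x * F z x - H z x"
    by (simp add: e_def pol_eqs left_diff_distrib sum_subtractf sum_distrib_left mult.assoc)
  finally show ?thesis .
qed

lemma dGx_eq: "Gx z x + z * dGx z x = m x * dF z x - dH z x"
proof -
  have "((\<lambda>z. z * Gx z x) has_real_derivative Gx z x + z * dGx z x) (at z)"
    by (rule DERIV_cong[OF DERIV_mult'[OF DERIV_ident z_derivs(4)]]) simp
  moreover have "((\<lambda>z. m x * F z x - H z x) has_real_derivative m x * dF z x - dH z x) (at z)"
    by (intro DERIV_diff DERIV_cmult z_derivs)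
  ultimately show ?thesis using DERIV_unique unfolding Gx_eq by blast
qed

lemma pol_bdd:
  "bdd_fun (\<lambda>x. F z x)" "bdd_fun (\<lambda>x. G z x)" "bdd_fun (\<lambda>x. H z x)"
  "bdd_fun (\<lambda>x. dF z x)" "bdd_fun (\<lambda>x. dG z x)" "bdd_fun (\<lambda>x. dH z x)"
  unfolding pol_eqs dF_def dG_def dH_def
  by (intro bdd_fun_sum bdd_fun_mult bdd_fun_const coeffs_bdd; simp)+

section \<open>Branch points and the lower bound for m\<close>

lemma E_less: "i < j \<Longrightarrow> j \<le> 2 * n + 1 \<Longrightarrow> E i < E j"
proof (induction j)
  case (Suc j)
  then have "E j < E (Suc j)" using Eord by simp
  then show ?case using Suc by (cases "i = j") auto
qed simp

lemma E_neg: "i \<le> 2 * n \<Longrightarrow> E i < 0"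
  using E_less[of i "2 * n + 1"] Elast by simp

lemma E_inj: "inj_on E {..<2 * n + 2}"
proof (rule inj_onI, rule ccontr)
  fix i j assume ij: "i \<in> {..<2 * n + 2}" "j \<in> {..<2 * n + 2}" "E i = E j" "i \<noteq> j"
  then consider "i < j" "j \<le> 2 * n + 1" | "j < i" "i \<le> 2 * n + 1" by fastforce
  then show False using E_less[of i j] E_less[of j i] ij(3) by cases auto
qed

text \<open>Both sides are the value of R/z at z = 0, where F = f_n and H = m f_n.\<close>

lemma m_f_n: "m x * (f n x)\<^sup>2 = (\<Prod>i<2*n+1. - E i)"
proof -
  define D where "D z = z * (G z x)\<^sup>2 + F z x * H z x - (\<Prod>i<2*n+1. z - E i)" for z
  have "D z = 0" if "z \<noteq> 0" for z
  proof -
    have "R z = z * (\<Prod>i<2*n+1. z - E i)" using Elast by (simp add: R_def)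
    then have "z * D z = 0"
      using R_eq[of z x] by (simp add: D_def algebra_simps power2_eq_square)
    then show ?thesis using that by simp
  qed
  moreover have "isCont D 0" unfolding D_def
    using DERIV_isCont[OF z_derivs(1)] DERIV_isCont[OF z_derivs(2)] DERIV_isCont[OF z_derivs(3)]
    by (intro continuous_intros) auto
  ultimately have "D 0 = 0" by (rule continuous_zero_at[rotated])
  moreover have "(\<Sum>l\<le>n. a l * 0 ^ l) = a 0" for a :: "nat \<Rightarrow> real"
    using sum.atMost_shift[of "\<lambda>l. a l * 0 ^ l" n] by simp
  from this[of "\<lambda>l. f (n - l) x"] this[of "\<lambda>l. h (n - l) x"]
  have "F 0 x = f n x" "H 0 x = m x * f n x" by (simp_all add: pol_eqs h_n)
  ultimately show ?thesis by (simp add: D_def power2_eq_square mult_ac del: prod.lessThan_Suc)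
qed

text \<open>Supplies the positive lower bound on \<open>q\<close> that \<open>triple_flow\<close>
  demands; boundedness of f_n enters through \<open>m_f_n\<close>.\<close>

lemma m_lower: obtains c where "c > 0" "\<And>x. m x \<ge> c"
proof -
  define c0 where "c0 = (\<Prod>i<2*n+1. - E i)"
  have c0: "c0 > 0" unfolding c0_def by (rule prod_pos) (use E_neg in auto)
  obtain M where M: "\<And>x. \<bar>f n x\<bar> \<le> M" using coeffs_bdd(1)[of n] by (auto simp: bdd_fun_def)
  have "m x \<ge> c0 / (M\<^sup>2 + 1)" for x
  proof -
    have "(f n x)\<^sup>2 \<le> M\<^sup>2" using M[of x] by (metis abs_ge_zero power2_abs power_mono)
    then have "c0 \<le> m x * (M\<^sup>2 + 1)"
      unfolding c0_def m_f_n[of x, symmetric] using m_pos[of x] by (intro mult_left_mono) auto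
    moreover have "M\<^sup>2 + 1 > 0" by (simp add: add_nonneg_pos)
    ultimately show ?thesis by (simp add: pos_divide_le_eq)
  qed
  then show ?thesis using c0 by (intro that[of "c0 / (M\<^sup>2 + 1)"]) (auto simp: add_nonneg_pos)
qed

lemma R_root: "i < 2 * n + 2 \<Longrightarrow> R (E i) = 0"
  unfolding R_def by (rule prod_zero) auto

text \<open>The negative factors are those with index at least 2j, and their number 2n + 2 - 2j is
  even.\<close>

lemma R_pos_gap:
  assumes j: "j \<in> {1..n}" and z: "E (2*j-1) < z" "z < E (2*j)"
  shows "R z > 0"
proof -
  have split: "{..<2*n+2} = {..<2*j} \<union> {2*j..<2*n+2}" using j by auto
  have low: "E i < z" if "i < 2*j" for i
  proof -
    have "2*j-1 \<le> 2*n+1" "i < 2*j-1 \<or> i = 2*j-1" using j that by auto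
    then show ?thesis using E_less[of i "2*j-1"] z by auto
  qed
  have high: "z < E i" if "2*j \<le> i" "i < 2*n+2" for i
    using E_less[of "2*j" i] j z that by (cases "i = 2*j") auto
  have "R z = (\<Prod>i<2*j. z - E i) * (\<Prod>i\<in>{2*j..<2*n+2}. z - E i)"
    unfolding R_def split by (rule prod.union_disjoint) auto
  also have "(\<Prod>i\<in>{2*j..<2*n+2}. z - E i) = (\<Prod>i\<in>{2*j..<2*n+2}. (-1) * (E i - z))" by simp
  also have "\<dots> = (-1) ^ (2*n+2 - 2*j) * (\<Prod>i\<in>{2*j..<2*n+2}. E i - z)"
    unfolding prod.distrib by simp
  also have "(-1 :: real) ^ (2*n+2 - 2*j) = 1" by simp
  finally show ?thesis
    using low high by (auto intro!: mult_pos_pos prod_pos)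
qed

lemma flow:
  assumes z: "z \<noteq> 0" and R: "R z > 0"
  obtains P c M where "((\<lambda>z. R z / z\<^sup>2) has_real_derivative P) (at z)"
    and "triple_flow (\<lambda>x. F z x) (\<lambda>x. G z x) (\<lambda>x. H z x / z) (\<lambda>x. dF z x) (\<lambda>x. dG z x)
      (\<lambda>x. dH z x / z - H z x / z\<^sup>2) (\<lambda>x. m x / z) (\<lambda>x. m x / z\<^sup>2) P (R z / z\<^sup>2) c M"
proof -
  define P where "P x = 2 * G z x * dG z x + dF z x * (H z x / z) + F z x * (dH z x / z - H z x / z\<^sup>2)" for x
  have Q: "(G z x)\<^sup>2 + F z x * (H z x / z) = R z / z\<^sup>2" if "z \<noteq> 0" for z x
    unfolding R_eq[of z x, symmetric] using that by (simp add: field_simps power2_eq_square)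
  have dQ: "((\<lambda>z. R z / z\<^sup>2) has_real_derivative P x) (at z)" for x
  proof (rule has_field_derivative_transform_within_open[where S = "- {0}"])
    show "((\<lambda>z. (G z x)\<^sup>2 + F z x * (H z x / z)) has_real_derivative P x) (at z)"
      unfolding P_def
      by (rule derivative_eq_intros z_derivs refl z)+ (use z in \<open>simp add: field_simps power2_eq_square\<close>)
  qed (use z Q in auto)
  obtain c where c: "c > 0" "\<And>x. m x \<ge> c" using m_lower by blast
  \<comment> \<open>One bound for the sum of the six absolute values serves as the common constant
    \<open>M\<close>.\<close>
  have "bdd_fun (\<lambda>x. \<bar>F z x\<bar> + \<bar>G z x\<bar> + \<bar>H z x / z\<bar> + \<bar>dF z x\<bar> + \<bar>dG z x\<bar> + \<bar>dH z x / z - H z x / z\<^sup>2\<bar>)"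
  proof -
    have ab: "bdd_fun k \<Longrightarrow> bdd_fun (\<lambda>x. \<bar>k x\<bar>)" for k by (simp add: bdd_fun_def)
    show ?thesis by (intro bdd_fun_add ab bdd_fun_diff bdd_fun_divide pol_bdd)
  qed
  then obtain M where M: "\<And>x. \<bar>\<bar>F z x\<bar> + \<bar>G z x\<bar> + \<bar>H z x / z\<bar> + \<bar>dF z x\<bar> + \<bar>dG z x\<bar> + \<bar>dH z x / z - H z x / z\<^sup>2\<bar>\<bar> \<le> M"
    unfolding bdd_fun_def by blast
  have aux: "a1 \<le> M \<and> a2 \<le> M \<and> a3 \<le> M \<and> a4 \<le> M \<and> a5 \<le> M \<and> a6 \<le> M"
    if "a1 + a2 + a3 + a4 + a5 + a6 \<le> M" "0 \<le> a1" "0 \<le> a2" "0 \<le> a3" "0 \<le> a4" "0 \<le> a5" "0 \<le> a6"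
    for a1 a2 a3 a4 a5 a6 :: real
    using that by linarith
  show ?thesis
  \<comment> \<open>Each P x is the z-derivative of the same x-independent function R/z^2, so
    evaluation at x = 0 is no restriction.\<close>
  proof (rule that[OF dQ[of 0]])
    show "triple_flow (\<lambda>x. F z x) (\<lambda>x. G z x) (\<lambda>x. H z x / z) (\<lambda>x. dF z x) (\<lambda>x. dG z x)
      (\<lambda>x. dH z x / z - H z x / z\<^sup>2) (\<lambda>x. m x / z) (\<lambda>x. m x / z\<^sup>2) (P 0) (R z / z\<^sup>2) (c / z\<^sup>2) M"
    proof
      fix x
      show "((\<lambda>x. F z x) has_real_derivative 2 * G z x - 2 * F z x) (at x)" by (rule F_flow)
      show "((\<lambda>x. dF z x) has_real_derivative 2 * dG z x - 2 * dF z x) (at x)" by (rule dF_flow)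
      have Gx: "Gx z x = m x / z * F z x - H z x / z"
        using Gx_eq[of z x] z by (simp add: field_simps)
      show "((\<lambda>x. G z x) has_real_derivative m x / z * F z x - H z x / z) (at x)"
        using G_flow[of z x] unfolding Gx .
      have "dGx z x = (m x * dF z x - dH z x - Gx z x) / z"
        using dGx_eq[of z x] z by (simp add: field_simps)
      also have "\<dots> = m x / z * dF z x - (dH z x / z - H z x / z\<^sup>2) - m x / z\<^sup>2 * F z x"
        unfolding Gx using z by (simp add: field_simps power2_eq_square)
      finally show "((\<lambda>x. dG z x) has_real_derivative
          m x / z * dF z x - (dH z x / z - H z x / z\<^sup>2) - m x / z\<^sup>2 * F z x) (at x)"
        using dG_flow[of z x] by simp
      show "((\<lambda>x. H z x / z) has_real_derivative 2 * (H z x / z) - 2 * (m x / z) * G z x) (at x)"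
        by (rule DERIV_cong[OF DERIV_cdivide[OF H_flow]]) (use z in \<open>simp add: field_simps\<close>)
      show "((\<lambda>x. dH z x / z - H z x / z\<^sup>2) has_real_derivative
          2 * (dH z x / z - H z x / z\<^sup>2) - 2 * (m x / z) * dG z x + 2 * (m x / z\<^sup>2) * G z x) (at x)"
        by (rule DERIV_cong[OF DERIV_diff[OF DERIV_cdivide[OF dH_flow] DERIV_cdivide[OF H_flow]]])
          (use z in \<open>simp add: field_simps power2_eq_square\<close>)
      show "(G z x)\<^sup>2 + F z x * (H z x / z) = R z / z\<^sup>2" by (rule Q[OF z])
      show "2 * G z x * dG z x + dF z x * (H z x / z) + F z x * (dH z x / z - H z x / z\<^sup>2) = P 0"
        using DERIV_unique[OF dQ[of x] dQ[of 0]] by (simp add: P_def)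
      show "R z / z\<^sup>2 > 0" using z R by simp
      show "m x / z\<^sup>2 \<ge> c / z\<^sup>2" using c by (intro divide_right_mono) auto
      show "c / z\<^sup>2 > 0" using c z by simp
      show "continuous_on UNIV (\<lambda>x. m x / z\<^sup>2)"
        by (intro continuous_intros C_inf_continuous_on[OF m_smooth]) (use z in auto)
      show "\<bar>F z x\<bar> \<le> M" "\<bar>G z x\<bar> \<le> M" "\<bar>H z x / z\<bar> \<le> M" "\<bar>dF z x\<bar> \<le> M" "\<bar>dG z x\<bar> \<le> M"
        "\<bar>dH z x / z - H z x / z\<^sup>2\<bar> \<le> M"
        using aux[OF order_trans[OF abs_ge_self M[of x]]] by simp_all
    qed
  qed
qed

section \<open>Existence of a zero of F and of H in every gap\<close>

text \<open>Rolle's theorem for (R/z^2)/k^2, which vanishes at both ends of the gap. The conclusion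
  is cleared of denominators, the form refuted by \<open>F_log_derivative\<close> and
  \<open>V_log_derivative\<close>.\<close>

lemma gap_critical_point:
  assumes j: "j \<in> {1..n}"
    and k: "\<And>z. z \<in> {E (2*j-1)..E (2*j)} \<Longrightarrow> (k has_real_derivative k' z) (at z)"
    and nz: "\<And>z. z \<in> {E (2*j-1)..E (2*j)} \<Longrightarrow> k z \<noteq> 0"
  obtains z where "z \<in> {E (2*j-1)<..<E (2*j)}"
    "\<And>P. ((\<lambda>z. R z / z\<^sup>2) has_real_derivative P) (at z) \<Longrightarrow> P * k z = 2 * (R z / z\<^sup>2) * k' z"
proof -
  define a b where "a = E (2*j-1)" and "b = E (2*j)"
  have "a < b" unfolding a_def b_def using j by (intro E_less) auto
  have "b < 0" unfolding b_def using j by (intro E_neg) auto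
  have Rd: "\<exists>P. ((\<lambda>z. R z / z\<^sup>2) has_real_derivative P) (at z)" if "z < 0" for z
  proof -
    have "\<exists>d. (R has_real_derivative d) (at z)"
      unfolding R_def by (rule exI, rule has_field_derivative_prod) (auto intro!: derivative_eq_intros)
    then obtain d where "(R has_real_derivative d) (at z)" ..
    then show ?thesis using that by (intro exI) (auto intro!: derivative_eq_intros)
  qed
  have der: "((\<lambda>z. (R z / z\<^sup>2) / (k z)\<^sup>2) has_real_derivative
      (P * (k z)\<^sup>2 - (R z / z\<^sup>2) * (2 * k z * k' z)) / ((k z)\<^sup>2 * (k z)\<^sup>2)) (at z)"
    if "z \<in> {a..b}" "((\<lambda>z. R z / z\<^sup>2) has_real_derivative P) (at z)" for z P
  proof -
    have "((\<lambda>z. (k z)\<^sup>2) has_real_derivative 2 * k z * k' z) (at z)"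
      using k[of z] that by (auto intro!: derivative_eq_intros simp: a_def b_def)
    then show ?thesis using nz[of z] that by (intro DERIV_divide) (auto simp: a_def b_def)
  qed
  have "\<exists>z>a. z < b \<and> ((\<lambda>z. (R z / z\<^sup>2) / (k z)\<^sup>2) has_real_derivative 0) (at z)"
  proof (rule Rolle[OF \<open>a < b\<close>])
    show "(R a / a\<^sup>2) / (k a)\<^sup>2 = (R b / b\<^sup>2) / (k b)\<^sup>2"
    proof -
      have "2*j-1 < 2*n+2" "2*j < 2*n+2" using j by auto
      then have "R a = 0" "R b = 0" unfolding a_def b_def by (blast intro: R_root)+
      then show ?thesis by simp
    qed
    have D: "\<exists>d. ((\<lambda>z. (R z / z\<^sup>2) / (k z)\<^sup>2) has_real_derivative d) (at z)" if "z \<in> {a..b}" for z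
    proof -
      have "z < 0" using that \<open>b < 0\<close> by simp
      then show ?thesis using Rd der[OF that] by blast
    qed
    show "continuous_on {a..b} (\<lambda>z. (R z / z\<^sup>2) / (k z)\<^sup>2)"
      using D DERIV_isCont continuous_at_imp_continuous_on by blast
    show "(\<lambda>z. (R z / z\<^sup>2) / (k z)\<^sup>2) differentiable (at z)" if "a < z" "z < b" for z
      using D[of z] that by (auto simp: real_differentiable_def)
  qed
  then obtain z where z: "a < z" "z < b" "((\<lambda>z. (R z / z\<^sup>2) / (k z)\<^sup>2) has_real_derivative 0) (at z)"
    by blast
  show ?thesis
  proof (rule that[of z])
    show "z \<in> {E (2*j-1)<..<E (2*j)}" using z by (simp add: a_def b_def)
    fix P assume P: "((\<lambda>z. R z / z\<^sup>2) has_real_derivative P) (at z)"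
    have kz: "k z \<noteq> 0" using nz z by (simp add: a_def b_def)
    have "(P * (k z)\<^sup>2 - (R z / z\<^sup>2) * (2 * k z * k' z)) / ((k z)\<^sup>2 * (k z)\<^sup>2) = 0"
      using DERIV_unique[OF der[OF _ P] z(3)] z by simp
    then have "P * (k z)\<^sup>2 - (R z / z\<^sup>2) * (2 * k z * k' z) = 0" using kz by simp
    then have "k z * (P * k z - 2 * (R z / z\<^sup>2) * k' z) = 0"
      by (simp add: algebra_simps power2_eq_square)
    then show "P * k z = 2 * (R z / z\<^sup>2) * k' z" using kz by simp
  qed
qed

lemma F_zero_in_gap:
  assumes j: "j \<in> {1..n}"
  shows "\<exists>z\<in>{E (2*j-1)..E (2*j)}. F z x = 0"
proof (rule ccontr)
  assume none: "\<not> ?thesis"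
  then obtain z where z: "z \<in> {E (2*j-1)<..<E (2*j)}"
    and c: "\<And>P. ((\<lambda>z. R z / z\<^sup>2) has_real_derivative P) (at z) \<Longrightarrow> P * F z x = 2 * (R z / z\<^sup>2) * dF z x"
    using gap_critical_point[OF j, of "\<lambda>z. F z x" "\<lambda>z. dF z x"] z_derivs by blast
  have "z \<noteq> 0" using z E_neg[of "2*j"] j by auto
  moreover have "R z > 0" using R_pos_gap[OF j] z by simp
  ultimately obtain P c' M where P: "((\<lambda>z. R z / z\<^sup>2) has_real_derivative P) (at z)"
    and flow: "triple_flow (\<lambda>x. F z x) (\<lambda>x. G z x) (\<lambda>x. H z x / z) (\<lambda>x. dF z x) (\<lambda>x. dG z x)
      (\<lambda>x. dH z x / z - H z x / z\<^sup>2) (\<lambda>x. m x / z) (\<lambda>x. m x / z\<^sup>2) P (R z / z\<^sup>2) c' M"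
    using flow by blast
  have "F z x \<noteq> 0" using none z by force
  then show False using triple_flow.F_log_derivative[OF flow] c[OF P] by simp
qed

text \<open>Choosing one zero per gap fixes the increasing order; \<open>F_prod\<close> shows that
  no other zeros exist.\<close>

definition \<mu> where "\<mu> j x = (SOME z. z \<in> {E (2*j-1)..E (2*j)} \<and> F z x = 0)"

lemma mu:
  assumes "j \<in> {1..n}"
  shows "\<mu> j x \<in> {E (2*j-1)..E (2*j)}" "F (\<mu> j x) x = 0"
  using someI_ex[of "\<lambda>z. z \<in> {E (2*j-1)..E (2*j)} \<and> F z x = 0"] F_zero_in_gap[OF assms, of x]
  unfolding \<mu>_def by blast+

lemma gap_separated:
  assumes "i \<in> {1..n}" "j \<in> {1..n}" "i < j" "a \<in> {E (2*i-1)..E (2*i)}" "b \<in> {E (2*j-1)..E (2*j)}"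
  shows "a < b"
proof -
  have "E (2*i) < E (2*j-1)" using assms(1-3) by (intro E_less) auto
  then show ?thesis using assms(4,5) by simp
qed

lemma gap_points_inj:
  assumes "\<And>j. j \<in> {1..n} \<Longrightarrow> r j \<in> {E (2*j-1)..E (2*j)}"
  shows "inj_on r {1..n}"
proof (rule inj_onI, rule ccontr)
  fix i j assume ij: "i \<in> {1..n}" "j \<in> {1..n}" "r i = r j" "i \<noteq> j"
  then consider "i < j" | "j < i" by linarith
  then show False
    using gap_separated[OF ij(1,2) _ assms[OF ij(1)] assms[OF ij(2)]]
      gap_separated[OF ij(2,1) _ assms[OF ij(2)] assms[OF ij(1)]] ij(3) by cases auto
qed

text \<open>The \<open>n\<close> chosen zeros lie in disjoint gaps, hence are distinct, and the
  leading coefficient is f_0 = 1. The general field type includes complex z, so all zeros are seen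
  to be real.\<close>

lemma F_prod: "Fpol n f z x = (\<Prod>j\<in>{1..n}. z - of_real (\<mu> j x))" for z :: "'a::real_field"
proof -
  have "(\<Sum>l\<le>n. of_real (f (n - l) x) * z ^ l)
      = of_real (f (n - n) x) * (\<Prod>j\<in>{1..n}. z - of_real (\<mu> j x))"
  proof (rule sum_power_eq_prod_roots)
    fix j assume "j \<in> {1..n}"
    then have "of_real (F (\<mu> j x) x) = (0 :: 'a)" using mu by simp
    then show "(\<Sum>l\<le>n. of_real (f (n - l) x) * (of_real (\<mu> j x) :: 'a) ^ l) = 0"
      by (simp add: pol_eqs)
  next
    have "inj_on (\<lambda>j. \<mu> j x) {1..n}" by (rule gap_points_inj) (rule mu)
    then show "inj_on (\<lambda>j. of_real (\<mu> j x) :: 'a) {1..n}"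
      unfolding inj_on_def of_real_eq_iff .
  qed
  then show ?thesis by (simp add: Fpol_def f_0)
qed

lemma F_prod_real: "F z x = (\<Prod>j\<in>{1..n}. z - \<mu> j x)"
  using F_prod[of z x] by simp

lemma dF_mu:
  assumes "j \<in> {1..n}"
  shows "dF (\<mu> j x) x = (\<Prod>l\<in>{1..n} - {j}. \<mu> j x - \<mu> l x)"
proof -
  have "((\<lambda>z. F z x) has_real_derivative (\<Prod>l\<in>{1..n} - {j}. \<mu> j x - \<mu> l x)) (at (\<mu> j x))"
    unfolding F_prod_real by (rule has_deriv_prod_at_root) (use assms in auto)
  then show ?thesis by (rule DERIV_unique[OF z_derivs(1)])
qed

lemma mu_diff_nonzero:
  assumes j: "j \<in> {1..n}" and l: "l \<in> {1..n} - {j}" and a: "a \<in> {E (2*j-1)..E (2*j)}"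
  shows "a - \<mu> l x \<noteq> 0"
proof -
  have l': "l \<in> {1..n}" using l by simp
  consider "l < j" | "j < l" using l by fastforce
  then show ?thesis
    using gap_separated[OF j l' _ a mu(1)[OF l']] gap_separated[OF l' j _ mu(1)[OF l'] a]
    by cases (blast | simp)+
qed

text \<open>Zeros in disjoint gaps are distinct. This discharges the assumption \<open>FFz\<close>
  of \<open>V_log_derivative\<close>.\<close>

lemma F_simple_zeros: "F z x = 0 \<Longrightarrow> dF z x \<noteq> 0"
proof -
  assume "F z x = 0"
  then have "(\<Prod>j\<in>{1..n}. z - \<mu> j x) = 0" unfolding F_prod_real .
  then obtain j where j: "j \<in> {1..n}" "z = \<mu> j x" by (auto simp: prod_zero_iff)
  have "(\<Prod>l\<in>{1..n} - {j}. \<mu> j x - \<mu> l x) \<noteq> 0"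
    using mu_diff_nonzero[OF j(1) _ mu(1)[OF j(1)]] by simp
  then show "dF z x \<noteq> 0" unfolding j(2) dF_mu[OF j(1)] .
qed

text \<open>The same contradiction as for F, with k = H/z; the gaps lie left of 0, so the division
  is harmless.\<close>

lemma H_zero_in_gap:
  assumes j: "j \<in> {1..n}"
  shows "\<exists>z\<in>{E (2*j-1)..E (2*j)}. H z x = 0"
proof (rule ccontr)
  assume none: "\<not> ?thesis"
  have neg: "z < 0" if "z \<in> {E (2*j-1)..E (2*j)}" for z
    using that E_neg[of "2*j"] j by auto
  have d: "((\<lambda>z. H z x / z) has_real_derivative dH z x / z - H z x / z\<^sup>2) (at z)" if "z < 0" for z
    using that
    by (auto intro!: derivative_eq_intros z_derivs simp: field_simps power2_eq_square)
  have "H z x / z \<noteq> 0" if "z \<in> {E (2*j-1)..E (2*j)}" for z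
    using none that neg[OF that] by auto
  then obtain z where z: "z \<in> {E (2*j-1)<..<E (2*j)}"
    and c: "\<And>P. ((\<lambda>z. R z / z\<^sup>2) has_real_derivative P) (at z)
      \<Longrightarrow> P * (H z x / z) = 2 * (R z / z\<^sup>2) * (dH z x / z - H z x / z\<^sup>2)"
    using gap_critical_point[OF j, of "\<lambda>z. H z x / z" "\<lambda>z. dH z x / z - H z x / z\<^sup>2"] d neg by blast
  have "z \<noteq> 0" using neg[of z] z by auto
  moreover have "R z > 0" using R_pos_gap[OF j] z by simp
  ultimately obtain P c' M where P: "((\<lambda>z. R z / z\<^sup>2) has_real_derivative P) (at z)"
    and flow: "triple_flow (\<lambda>x. F z x) (\<lambda>x. G z x) (\<lambda>x. H z x / z) (\<lambda>x. dF z x) (\<lambda>x. dG z x)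
      (\<lambda>x. dH z x / z - H z x / z\<^sup>2) (\<lambda>x. m x / z) (\<lambda>x. m x / z\<^sup>2) P (R z / z\<^sup>2) c' M"
    using flow by blast
  have "H z x / z \<noteq> 0" using none z \<open>z \<noteq> 0\<close> by force
  then show False
    using triple_flow.V_log_derivative[OF flow] F_simple_zeros c[OF P] by blast
qed

definition \<nu> where "\<nu> j x = (SOME z. z \<in> {E (2*j-1)..E (2*j)} \<and> H z x = 0)"

lemma nu:
  assumes "j \<in> {1..n}"
  shows "\<nu> j x \<in> {E (2*j-1)..E (2*j)}" "H (\<nu> j x) x = 0"
  using someI_ex[of "\<lambda>z. z \<in> {E (2*j-1)..E (2*j)} \<and> H z x = 0"] H_zero_in_gap[OF assms, of x]
  unfolding \<nu>_def by blast+

lemma H_prod: "Hpol u n f z x = of_real (h 0 x) * (\<Prod>j\<in>{1..n}. z - of_real (\<nu> j x))"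
  for z :: "'a::real_field"
proof -
  have "(\<Sum>l\<le>n. of_real (h (n - l) x) * z ^ l)
      = of_real (h (n - n) x) * (\<Prod>j\<in>{1..n}. z - of_real (\<nu> j x))"
  proof (rule sum_power_eq_prod_roots)
    fix j assume "j \<in> {1..n}"
    then have "of_real (H (\<nu> j x) x) = (0 :: 'a)" using nu by simp
    then show "(\<Sum>l\<le>n. of_real (h (n - l) x) * (of_real (\<nu> j x) :: 'a) ^ l) = 0"
      by (simp add: pol_eqs)
  next
    have "inj_on (\<lambda>j. \<nu> j x) {1..n}" by (rule gap_points_inj) (rule nu)
    then show "inj_on (\<lambda>j. of_real (\<nu> j x) :: 'a) {1..n}"
      unfolding inj_on_def of_real_eq_iff .
  qed
  then show ?thesis by (simp add: Hpol_def)
qed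

subsection \<open>Motion of the zeros of F\<close>

lemma mu_neg: "j \<in> {1..n} \<Longrightarrow> \<mu> j x < 0"
  using mu(1)[of j x] E_neg[of "2 * j"] by auto

text \<open>With a = \<mu>_j(x0) fixed, the factors of F(a, x) other than a - \<mu>_j(x) stay away
  from 0 because the gaps are separated. So |a - \<mu>_j(x)| is at most a constant times |F(a, x)|,
  which tends to 0.\<close>

lemma mu_isCont:
  assumes j: "j \<in> {1..n}"
  shows "isCont (\<mu> j) x0"
proof -
  define a where "a = \<mu> j x0"
  have a: "a \<in> {E (2*j-1)..E (2*j)}" using mu(1)[OF j] by (simp add: a_def)
  \<comment> \<open>The distance between gap \<open>l\<close> and gap \<open>j\<close>.\<close>
  define \<delta> where "\<delta> l = (if l < j then E (2*j-1) - E (2*l) else E (2*l-1) - E (2*j))" for l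
  have \<delta>: "0 < \<delta> l \<and> \<delta> l \<le> \<bar>a - \<mu> l x\<bar>" if l: "l \<in> {1..n} - {j}" for l x
  proof -
    have l': "l \<in> {1..n}" using l by simp
    consider "l < j" | "j < l" using l by fastforce
    then show ?thesis
    proof cases
      case 1
      have "E (2*l) < E (2*j-1)" using 1 j by (intro E_less) auto
      then show ?thesis using 1 a mu(1)[OF l', of x] by (simp add: \<delta>_def)
    next
      case 2
      have "E (2*j) < E (2*l-1)" using 2 l' by (intro E_less) auto
      then show ?thesis using 2 a mu(1)[OF l', of x] by (simp add: \<delta>_def)
    qed
  qed
  define d where "d = (\<Prod>l\<in>{1..n} - {j}. \<delta> l)"
  have "d > 0" unfolding d_def using \<delta> by (intro prod_pos) blast
  have bound: "\<bar>a - \<mu> j x\<bar> \<le> \<bar>F a x\<bar> / d" for x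
  proof -
    have "\<bar>F a x\<bar> = \<bar>a - \<mu> j x\<bar> * (\<Prod>l\<in>{1..n} - {j}. \<bar>a - \<mu> l x\<bar>)"
      unfolding F_prod_real using j by (subst prod.remove[of _ j]) (auto simp: abs_mult abs_prod)
    moreover have "d \<le> (\<Prod>l\<in>{1..n} - {j}. \<bar>a - \<mu> l x\<bar>)"
      unfolding d_def using \<delta> by (intro prod_mono) (simp add: less_imp_le)
    ultimately have "\<bar>a - \<mu> j x\<bar> * d \<le> \<bar>F a x\<bar>"
      by (simp add: mult_left_mono)
    then show ?thesis using \<open>d > 0\<close> by (simp add: pos_le_divide_eq)
  qed
  have "((\<lambda>x. F a x) \<longlongrightarrow> F a x0) (at x0)"
    using DERIV_isCont[OF F_flow] by (simp add: isCont_def)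
  then have "((\<lambda>x. \<bar>F a x\<bar> / d) \<longlongrightarrow> 0) (at x0)"
    using mu(2)[OF j, of x0] by (auto intro!: tendsto_divide_zero tendsto_rabs_zero simp: a_def)
  then have "((\<lambda>x. \<bar>a - \<mu> j x\<bar>) \<longlongrightarrow> 0) (at x0)"
    by (rule tendsto_sandwich[OF _ _ tendsto_const, rotated 2]) (auto intro!: always_eventually bound)
  then have "((\<lambda>x. a - \<mu> j x) \<longlongrightarrow> 0) (at x0)" by (rule tendsto_rabs_zero_cancel)
  from tendsto_diff[OF tendsto_const[of a] this] show ?thesis
    by (simp add: isCont_def a_def)
qed

text \<open>Caratheodory's criterion replaces the implicit function theorem. Dividing F(a, y) = k(y)
  (y - x) by the factors a - \<mu>_l(y) yields the difference quotient of \<mu>_j, continuous by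
  \<open>mu_isCont\<close>; at y = x the flow gives k = 2G.\<close>

lemma mu_deriv:
  assumes j: "j \<in> {1..n}"
  shows "(\<mu> j has_real_derivative - 2 * G (\<mu> j x) x * (\<Prod>l\<in>{1..n} - {j}. inverse (\<mu> j x - \<mu> l x))) (at x)"
proof -
  define a where "a = \<mu> j x"
  have a: "a \<in> {E (2*j-1)..E (2*j)}" using mu(1)[OF j] by (simp add: a_def)
  have Fa: "F a x = 0" using mu(2)[OF j] by (simp add: a_def)
  have "((\<lambda>y. F a y) has_real_derivative 2 * G a x) (at x)" using F_flow[of a x] Fa by simp
  then obtain k where k: "\<And>y. F a y = k y * (y - x)" "isCont k x" "k x = 2 * G a x"
    using Fa unfolding CARAT_DERIV by auto
  have "\<mu> j y - \<mu> j x = - k y * (\<Prod>l\<in>{1..n} - {j}. inverse (a - \<mu> l y)) * (y - x)" for y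
  proof -
    have nz: "(\<Prod>l\<in>{1..n} - {j}. a - \<mu> l y) \<noteq> 0"
      using mu_diff_nonzero[OF j _ a] by simp
    have "F a y = (a - \<mu> j y) * (\<Prod>l\<in>{1..n} - {j}. a - \<mu> l y)"
      unfolding F_prod_real using j by (subst prod.remove[of _ j]) auto
    then have "a - \<mu> j y = k y * (y - x) * inverse (\<Prod>l\<in>{1..n} - {j}. a - \<mu> l y)"
      using nz k(1)[of y] by (simp add: field_simps)
    then show ?thesis by (simp add: a_def prod_inversef[symmetric] o_def mult_ac)
  qed
  moreover have "isCont (\<lambda>y. - k y * (\<Prod>l\<in>{1..n} - {j}. inverse (a - \<mu> l y))) x"
    using mu_diff_nonzero[OF j _ a] by (intro continuous_intros k mu_isCont) auto
  ultimately show ?thesis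
    unfolding CARAT_DERIV using k(3)
    by (intro exI[of _ "\<lambda>y. - k y * (\<Prod>l\<in>{1..n} - {j}. inverse (a - \<mu> l y))"]) (auto simp: a_def)
qed

lemma ksmooth_G_along:
  assumes "ksmooth k r" shows "ksmooth k (\<lambda>x. G (r x) x)"
  unfolding pol_eqs
proof (intro ksmooth_sum ksmooth_mult ksmooth_power assms)
  show "ksmooth k (g (n - l))" for l
    using g_smooth[of "n - l"] by (simp add: C_inf_iff_ksmooth)
qed

text \<open>The derivative in \<open>mu_deriv\<close> is built from the zeros and smooth
  coefficients, so all zeros gain one order simultaneously.\<close>

lemma mu_ksmooth: "j \<in> {1..n} \<Longrightarrow> ksmooth k (\<mu> j)"
proof (induction k arbitrary: j)
  case (Suc k)
  show ?case
  proof (rule ksmooth_SucI[OF mu_deriv[OF Suc.prems]])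
    have "ksmooth k (\<lambda>x. inverse (\<mu> j x - \<mu> l x))" if "l \<in> {1..n} - {j}" for l
      using Suc that mu_diff_nonzero[OF Suc.prems that mu(1)[OF Suc.prems]]
      by (intro ksmooth_inverse ksmooth_diff) auto
    then show "ksmooth k (\<lambda>x. - 2 * G (\<mu> j x) x * (\<Prod>l\<in>{1..n} - {j}. inverse (\<mu> j x - \<mu> l x)))"
      using Suc by (intro ksmooth_mult ksmooth_prod ksmooth_const ksmooth_G_along) auto
  qed
qed simp

section \<open>Passage through a branch point\<close>

text \<open>R and F both vanish there, which leaves z^2 G^2 = 0 with z = \<mu>_j < 0.\<close>

lemma G_mu_zero:
  assumes j: "j \<in> {1..n}" and e: "\<mu> j x = E i" "i < 2 * n + 2"
  shows "G (\<mu> j x) x = 0"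
proof -
  have "(\<mu> j x)\<^sup>2 * (G (\<mu> j x) x)\<^sup>2 = 0"
    using R_eq[of "\<mu> j x" x] R_root[OF e(2)] mu(2)[OF j, of x] e(1) by simp
  then show ?thesis using mu_neg[OF j, of x] by simp
qed

text \<open>Otherwise F, G and H all vanish there, so the z-derivative of R vanishes at E_i,
  although the E_i are distinct.\<close>

lemma H_mu_nonzero:
  assumes j: "j \<in> {1..n}" and e: "\<mu> j x = E i" "i < 2 * n + 2"
  shows "H (\<mu> j x) x \<noteq> 0"
proof
  assume H0: "H (\<mu> j x) x = 0"
  have "((\<lambda>z. z\<^sup>2 * (G z x)\<^sup>2 + z * F z x * H z x) has_real_derivative 0) (at (\<mu> j x))"
    using H0 G_mu_zero[OF assms] mu(2)[OF j, of x]
    by (auto intro!: derivative_eq_intros z_derivs)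
  then have "(R has_real_derivative 0) (at (E i))"
    unfolding R_eq e(1) .
  moreover have "(R has_real_derivative (\<Prod>l\<in>{..<2*n+2} - {i}. E i - E l)) (at (E i))"
    unfolding R_def[abs_def] by (rule has_deriv_prod_at_root) (use e in auto)
  ultimately have "(\<Prod>l\<in>{..<2*n+2} - {i}. E i - E l) = 0" using DERIV_unique by blast
  then obtain l where "l \<in> {..<2*n+2} - {i}" "E i = E l" by auto
  then show False using E_inj e(2) by (auto dest: inj_onD)
qed

lemma G_along_deriv:
  assumes r: "(r has_real_derivative r') (at x)"
  shows "((\<lambda>x. G (r x) x) has_real_derivative Gx (r x) x + dG (r x) x * r') (at x)"
proof -
  have "((\<lambda>x. g (n - l) x * r x ^ l) has_real_derivative
      deriv (g (n - l)) x * r x ^ l + g (n - l) x * (real l * r x ^ (l - 1)) * r') (at x)" for l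
    using g_has_deriv[of "n - l" x] r by (auto intro!: derivative_eq_intros)
  then have "((\<lambda>x. \<Sum>l\<le>n. g (n - l) x * r x ^ l) has_real_derivative
      (\<Sum>l\<le>n. deriv (g (n - l)) x * r x ^ l + g (n - l) x * (real l * r x ^ (l - 1)) * r')) (at x)"
    by (rule DERIV_sum)
  then show ?thesis
    by (simp add: pol_eqs Gx_def dG_def sum.distrib sum_distrib_right)
qed

text \<open>Since G = 0, also \<mu>_j' = 0, and only the explicit x-derivative of G contributes:
  -\<mu>_j \<open>Gx\<close> = H - m F = H.\<close>

lemma sheet_deriv:
  assumes j: "j \<in> {1..n}" and e: "\<mu> j x = E i" "i < 2 * n + 2"
  shows "((\<lambda>x. - \<mu> j x * G (\<mu> j x) x) has_real_derivative H (\<mu> j x) x) (at x)"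
proof -
  have G0: "G (\<mu> j x) x = 0" by (rule G_mu_zero[OF assms])
  then have d0: "(\<mu> j has_real_derivative 0) (at x)" using mu_deriv[OF j, of x] by simp
  have "((\<lambda>x. - \<mu> j x * G (\<mu> j x) x) has_real_derivative - \<mu> j x * Gx (\<mu> j x) x) (at x)"
    using DERIV_mult[OF DERIV_minus[OF d0] G_along_deriv[OF d0]] G0 by (simp add: mult.commute)
  moreover have "- \<mu> j x * Gx (\<mu> j x) x = H (\<mu> j x) x"
    using Gx_eq[of "\<mu> j x" x] mu(2)[OF j, of x] by simp
  ultimately show ?thesis by simp
qed

text \<open>The y-coordinate vanishes at \<open>x0\<close> with nonzero slope, so it changes sign;
  over the interior of a gap the two signs of y are the two sheets.\<close>

lemma sheet_change:
  assumes j: "j \<in> {1..n}" and e: "\<mu> j x0 = E (2*j-1) \<or> \<mu> j x0 = E (2*j)"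
  shows "\<exists>\<epsilon>>0. \<exists>s\<in>{-1, 1::real}.
    (\<forall>x. x0 - \<epsilon> < x \<and> x < x0 \<longrightarrow> s * (- \<mu> j x * G (\<mu> j x) x) > 0) \<and>
    (\<forall>x. x0 < x \<and> x < x0 + \<epsilon> \<longrightarrow> s * (- \<mu> j x * G (\<mu> j x) x) < 0)"
proof -
  obtain i where i: "\<mu> j x0 = E i" "i < 2 * n + 2"
  proof -
    have "2*j-1 < 2*n+2" "2*j < 2*n+2" using j by auto
    then show ?thesis using e that by blast
  qed
  \<comment> \<open>This sign makes the slope of s * y at \<open>x0\<close> negative, whichever way
    the branch point is crossed.\<close>
  define s where "s = - sgn (H (\<mu> j x0) x0)"
  define y where "y x = s * (- \<mu> j x * G (\<mu> j x) x)" for x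
  have H0: "H (\<mu> j x0) x0 \<noteq> 0" by (rule H_mu_nonzero[OF j i])
  then have s: "s \<in> {-1, 1}" by (simp add: s_def sgn_if)
  have "(y has_real_derivative s * H (\<mu> j x0) x0) (at x0)"
    unfolding y_def by (rule DERIV_cmult[OF sheet_deriv[OF j i]])
  moreover have "s * H (\<mu> j x0) x0 < 0" using H0 by (simp add: s_def sgn_if)
  moreover have "y x0 = 0" using G_mu_zero[OF j i] by (simp add: y_def)
  ultimately obtain d1 d2 where d: "d1 > 0" "\<And>t. 0 < t \<Longrightarrow> t < d1 \<Longrightarrow> y (x0 + t) < 0"
    "d2 > 0" "\<And>t. 0 < t \<Longrightarrow> t < d2 \<Longrightarrow> y (x0 - t) > 0"
    using DERIV_neg_dec_right[of y _ x0] DERIV_neg_dec_left[of y _ x0] by metis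
  show ?thesis
  proof (intro exI[of _ "min d1 d2"] conjI bexI[OF _ s] allI impI)
    show "min d1 d2 > 0" using d by simp
    show "s * (- \<mu> j x * G (\<mu> j x) x) > 0" if "x0 - min d1 d2 < x \<and> x < x0" for x
      using d(4)[of "x0 - x"] that by (auto simp: y_def)
    show "s * (- \<mu> j x * G (\<mu> j x) x) < 0" if "x0 < x \<and> x < x0 + min d1 d2" for x
      using d(2)[of "x - x0"] that by (auto simp: y_def)
  qed
qed

end

theorem theorem5p4:
  fixes u :: "real \<Rightarrow> real" and n :: nat and f :: "nat \<Rightarrow> real \<Rightarrow> real"
    and E :: "nat \<Rightarrow> real"
  assumes smooth: "C_inf u"
    and bdd: "\<forall>k\<le>2. bounded (range ((deriv ^^ k) u))"
    and pos: "\<forall>x. 4 * u x - deriv (deriv u) x > 0"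
    and fseq: "is_f_seq u n f"
    and stat: "\<forall>x. sCH u n f x = 0"
    and Rform: "\<forall>(z::complex) x. z\<^sup>2 * (Gpol n f z x)\<^sup>2 + z * Fpol n f z x * Hpol u n f z x
                   = (\<Prod>m<2*n+2. z - of_real (E m))"
    and Eord: "\<forall>m<2*n+1. E m < E (m + 1)"
    and Elast: "E (2*n+1) = 0"
  shows "\<exists>\<mu> \<nu> :: nat \<Rightarrow> real \<Rightarrow> real.
     (\<forall>(z::complex) x. Fpol n f z x = (\<Prod>j\<in>{1..n}. z - of_real (\<mu> j x))) \<and>
     (\<forall>(z::complex) x. Hpol u n f z x = of_real (hh u n f 0 x) * (\<Prod>j\<in>{1..n}. z - of_real (\<nu> j x))) \<and>
     (\<forall>j\<in>{1..n}. \<forall>x. E (2*j-1) \<le> \<mu> j x \<and> \<mu> j x \<le> E (2*j)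
                     \<and> E (2*j-1) \<le> \<nu> j x \<and> \<nu> j x \<le> E (2*j)) \<and>
     (\<forall>j\<in>{1..n}. C_inf (\<mu> j) \<and> C_inf (\<lambda>x. - \<mu> j x * Gpol n f (\<mu> j x) x)) \<and>
     (\<forall>j\<in>{1..n}. \<forall>x. (\<mu> j has_real_derivative
         (2 * (- \<mu> j x * Gpol n f (\<mu> j x) x) / \<mu> j x
            * (\<Prod>l\<in>{1..n} - {j}. inverse (\<mu> j x - \<mu> l x)))) (at x)) \<and>
     (\<forall>j\<in>{1..n}. \<forall>x0. (\<mu> j x0 = E (2*j-1) \<or> \<mu> j x0 = E (2*j)) \<longrightarrow>
        (\<exists>\<epsilon>>0. \<exists>s\<in>{-1, 1::real}.
           (\<forall>x. x0 - \<epsilon> < x \<and> x < x0 \<longrightarrow> s * (- \<mu> j x * Gpol n f (\<mu> j x) x) > 0) \<and>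
           (\<forall>x. x0 < x \<and> x < x0 + \<epsilon> \<longrightarrow> s * (- \<mu> j x * Gpol n f (\<mu> j x) x) < 0)))"
proof -
  interpret stationary_CH u n f E
    by unfold_locales (fact smooth bdd pos fseq stat Rform Eord Elast)+
  show ?thesis
  proof (rule exI[of _ \<mu>], rule exI[of _ \<nu>], intro conjI ballI allI impI)
    fix z :: complex and x
    show "Fpol n f z x = (\<Prod>j\<in>{1..n}. z - of_real (\<mu> j x))" by (rule F_prod)
    show "Hpol u n f z x = of_real (hh u n f 0 x) * (\<Prod>j\<in>{1..n}. z - of_real (\<nu> j x))" by (rule H_prod)
  next
    fix j x assume j: "j \<in> {1..n}"
    show "E (2*j-1) \<le> \<mu> j x" "\<mu> j x \<le> E (2*j)" "E (2*j-1) \<le> \<nu> j x" "\<nu> j x \<le> E (2*j)"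
      using mu(1)[OF j, of x] nu(1)[OF j, of x] by auto
    show "(\<mu> j has_real_derivative
         (2 * (- \<mu> j x * Gpol n f (\<mu> j x) x) / \<mu> j x
            * (\<Prod>l\<in>{1..n} - {j}. inverse (\<mu> j x - \<mu> l x)))) (at x)"
      \<comment> \<open>Because \<mu>_j is negative it cancels, and the factor 2y/\<mu>_j is
        -2G.\<close>
      by (rule DERIV_cong[OF mu_deriv[OF j]]) (use mu_neg[OF j, of x] in simp)
  next
    fix j assume j: "j \<in> {1..n}"
    show "C_inf (\<mu> j)" using mu_ksmooth[OF j] by (simp add: C_inf_iff_ksmooth)
    show "C_inf (\<lambda>x. - \<mu> j x * Gpol n f (\<mu> j x) x)"
      unfolding C_inf_iff_ksmooth
      by (intro allI ksmooth_mult ksmooth_minus ksmooth_G_along mu_ksmooth[OF j])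
  next
    fix j x0 assume "j \<in> {1..n}" "\<mu> j x0 = E (2*j-1) \<or> \<mu> j x0 = E (2*j)"
    then show "\<exists>\<epsilon>>0. \<exists>s\<in>{-1, 1::real}.
       (\<forall>x. x0 - \<epsilon> < x \<and> x < x0 \<longrightarrow> s * (- \<mu> j x * Gpol n f (\<mu> j x) x) > 0) \<and>
       (\<forall>x. x0 < x \<and> x < x0 + \<epsilon> \<longrightarrow> s * (- \<mu> j x * Gpol n f (\<mu> j x) x) < 0)"
      by (rule sheet_change)
  qed
qed

end
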